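(* The point symmetry group $G^{\rm B}$ of the Burgers equation $v_t+vv_x=v_{xx}$ consists of the point transformations of the form $$\tilde t=\frac{\alpha t+\beta}{\gamma t+\delta},\qquad \tilde x=\frac{x+\lambda_1t+\lambda_0}{\gamma t+\delta},\qquad \tilde v=(\gamma t+\delta)v-\gamma x+\lambda_1\delta-\lambda_0\gamma,$$ where $\alpha,\beta,\gamma,\delta,\lambda_1,\lambda_0$ are arbitrary real constants with $\alpha\delta-\beta\gamma=1$.
   Context: A point transformation is a local diffeomorphism $(t,x,v)\mapsto(\tilde t,\tilde x,\tilde v)$ of $\mathbb R^3$. It is a point symmetry of the Burgers equation if it maps (locally) graphs of solutions $v=f(t,x)$ to graphs of solutions of the same equation. The description is local: near each point of its domain a point symmetry has the displayed form, and, conversely, any transformation of the displayed form, considered on its natural domain $\{\gamma t+\delta\ne0\}$, is a point symmetry. *)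

theory Defs
  imports "HOL-Analysis.Analysis"
begin

text \<open>
  Smoothness on an open set: all iterated directional derivatives exist and are continuous.
  The definitions are only used for open \<open>S\<close>.
\<close>

primrec Ck_on :: "nat \<Rightarrow> 'a::real_normed_vector set \<Rightarrow> ('a \<Rightarrow> 'b::real_normed_vector) \<Rightarrow> bool" where
  "Ck_on 0 S f \<longleftrightarrow> continuous_on S f"
| "Ck_on (Suc k) S f \<longleftrightarrow>
     (\<forall>x\<in>S. f differentiable (at x)) \<and>
     (\<forall>h. Ck_on k S (\<lambda>x. frechet_derivative f (at x) h))"

definition smooth_on :: "'a::real_normed_vector set \<Rightarrow> ('a \<Rightarrow> 'b::real_normed_vector) \<Rightarrow> bool" where
  "smooth_on S f \<longleftrightarrow> (\<forall>k. Ck_on k S f)"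

definition local_diffeomorphism_on ::
    "'a::real_normed_vector set \<Rightarrow> ('a \<Rightarrow> 'b::real_normed_vector) \<Rightarrow> bool" where
  "local_diffeomorphism_on U \<Phi> \<longleftrightarrow> open U \<and>
     (\<forall>p\<in>U. \<exists>N \<Psi>. open N \<and> p \<in> N \<and> N \<subseteq> U \<and> open (\<Phi> ` N) \<and>
        smooth_on N \<Phi> \<and> smooth_on (\<Phi> ` N) \<Psi> \<and> (\<forall>q\<in>N. \<Psi> (\<Phi> q) = q))"

text \<open>
  The space of independent variables \<open>(t, x)\<close> is \<open>real \<times> real\<close>; the space with
  coordinates \<open>(t, x, v)\<close> is \<open>real \<times> real \<times> real\<close>.
\<close>

definition burgers_solution :: "(real \<times> real) set \<Rightarrow> (real \<times> real \<Rightarrow> real) \<Rightarrow> bool" where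
  "burgers_solution D f \<longleftrightarrow> open D \<and> smooth_on D f \<and>
     (\<forall>(t, x)\<in>D.
        deriv (\<lambda>s. f (s, x)) t + f (t, x) * deriv (\<lambda>y. f (t, y)) x
        = (deriv ^^ 2) (\<lambda>y. f (t, y)) x)"

definition graph_point :: "(real \<times> real \<Rightarrow> real) \<Rightarrow> real \<times> real \<Rightarrow> real \<times> real \<times> real" where
  "graph_point f q = (fst q, snd q, f q)"

definition base_point :: "real \<times> real \<times> real \<Rightarrow> real \<times> real" where
  "base_point p = (fst p, fst (snd p))"

text \<open>
  The image under \<open>\<Phi>\<close> of the graph of \<open>f\<close>, near the point over \<open>q\<close>, is again the graph of
  a smooth function of the first two coordinates. For a local diffeomorphism this is, by the
  inverse function theorem, transversality of the image surface to the direction of the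
  third coordinate.
\<close>

definition image_is_graph_at ::
    "(real \<times> real \<times> real \<Rightarrow> real \<times> real \<times> real) \<Rightarrow> (real \<times> real \<Rightarrow> real) \<Rightarrow> real \<times> real \<Rightarrow> bool" where
  "image_is_graph_at \<Phi> f q \<longleftrightarrow>
     bij (frechet_derivative (\<lambda>r. base_point (\<Phi> (graph_point f r))) (at q))"

definition maps_graph_to_solution_graph_at ::
    "(real \<times> real \<times> real) set \<Rightarrow> (real \<times> real \<times> real \<Rightarrow> real \<times> real \<times> real) \<Rightarrow>
     (real \<times> real) set \<Rightarrow> (real \<times> real \<Rightarrow> real) \<Rightarrow> real \<times> real \<Rightarrow> bool" where
  "maps_graph_to_solution_graph_at U \<Phi> D f q \<longleftrightarrow>
     (\<exists>D' E g. open D' \<and> q \<in> D' \<and> D' \<subseteq> D \<and> graph_point f ` D' \<subseteq> U \<and>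
        burgers_solution E g \<and> \<Phi> ` graph_point f ` D' = graph_point g ` E)"

text \<open>
  As usual for point transformations, the transform of a solution is only required to be a
  solution where it is locally a function of the first two coordinates again (a general
  local diffeomorphism may turn a graph into a surface with vertical tangent directions).
\<close>

definition burgers_point_symmetry ::
    "(real \<times> real \<times> real) set \<Rightarrow> (real \<times> real \<times> real \<Rightarrow> real \<times> real \<times> real) \<Rightarrow> bool" where
  "burgers_point_symmetry U \<Phi> \<longleftrightarrow> local_diffeomorphism_on U \<Phi> \<and>
     (\<forall>D f q. burgers_solution D f \<and> q \<in> D \<and> graph_point f q \<in> U \<and> image_is_graph_at \<Phi> f q
        \<longrightarrow> maps_graph_to_solution_graph_at U \<Phi> D f q)"

definition burgers_transformation ::
    "real \<Rightarrow> real \<Rightarrow> real \<Rightarrow> real \<Rightarrow> real \<Rightarrow> real \<Rightarrow> real \<times> real \<times> real \<Rightarrow> real \<times> real \<times> real" where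
  "burgers_transformation \<alpha> \<beta> \<gamma> \<delta> l1 l0 = (\<lambda>(t, x, v).
     ((\<alpha> * t + \<beta>) / (\<gamma> * t + \<delta>),
      (x + l1 * t + l0) / (\<gamma> * t + \<delta>),
      (\<gamma> * t + \<delta>) * v - \<gamma> * x + l1 * \<delta> - l0 * \<gamma>))"

definition natural_domain :: "real \<Rightarrow> real \<Rightarrow> (real \<times> real \<times> real) set" where
  "natural_domain \<gamma> \<delta> = {(t, x, v). \<gamma> * t + \<delta> \<noteq> 0}"

end

theory Submission
  imports Defs
begin

text \<open>
  Near a point, the image of a solution \<open>f\<close> under \<open>\<Phi> = (T, X, V)\<close> is the graph of a function \<open>g\<close> with
  \<open>g (T, X) = V\<close> along the graph of \<open>f\<close>. Differentiating this twice expresses the Burgers equation for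
  \<open>g\<close> through the 2-jet of \<open>f\<close>. By the Cole--Hopf substitution the value of \<open>f\<close> and the derivatives
  \<open>f\<^sub>x\<close>, \<open>f\<^sub>x\<^sub>x\<close>, \<open>f\<^sub>t\<^sub>t\<close> can be prescribed at a point, so the identity splits with respect to them:
  \<open>f\<^sub>t\<^sub>t\<close> gives \<open>T\<^sub>x = T\<^sub>v = 0\<close>, then \<open>f\<^sub>x\<^sub>x\<close> gives \<open>X\<^sub>v = 0\<close> and \<open>X\<^sub>x\<^sup>2 = T\<^sub>t\<close>, and the
  powers of \<open>f\<^sub>x\<close> give the remaining determining equations. These force \<open>V\<close> to be
  \<open>(\<gamma> t + \<delta>) v - \<gamma> x + \<kappa>\<close> and fix all first derivatives of \<open>T\<close> and \<open>X\<close>; the transformation with the same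
  derivatives and the same value at one point then agrees with \<open>\<Phi>\<close> on a ball.
\<close>

subsection \<open>Directional derivatives and smooth functions\<close>

text \<open>A symmetry is tested on actual solutions only, so an identity between jets may be split
  only if enough solutions pass through each point; explicit heat polynomials provide them without
  any existence theory. The equation ties \<open>f_t\<close> to \<open>f_x\<close> and
  \<open>f_xx\<close>, whereas \<open>f_tt\<close> carries a fourth x-derivative and can be varied
  alone; hence it is split off before the others.

  A second obstacle is that the identity is available only for jets with
  \<open>\<Delta> = D_t T * D_x X - D_x T * D_t X\<close> nonzero, where the image is a graph. This
  determinant is affine in \<open>f_t\<close> and \<open>f_x\<close>, and a nonzero Jacobian
  prevents it from vanishing identically. Each splitting therefore uses a few admissible jet values
  instead of comparing coefficients of polynomials.

  Every point of a ball is treated separately, so the conclusions hold on the whole ball and may be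
  differentiated again. Doing so expresses the derivatives of \<open>V_x\<close> and
  \<open>V_v\<close> so completely that integration reduces to comparing functions with equal
  derivatives.\<close>

definition dir_deriv :: "'a::real_normed_vector \<Rightarrow> ('a \<Rightarrow> 'b::real_normed_vector) \<Rightarrow> 'a \<Rightarrow> 'b" where
  "dir_deriv h f x = frechet_derivative f (at x) h"

lemma dir_deriv_eq: "(f has_derivative f') (at x) \<Longrightarrow> dir_deriv h f x = f' h"
  by (metis dir_deriv_def frechet_derivative_at)

lemma has_derivative_dir_deriv:
  "f differentiable (at x) \<Longrightarrow> (f has_derivative (\<lambda>h. dir_deriv h f x)) (at x)"
  unfolding dir_deriv_def using frechet_derivative_works by blast

text \<open>Functions that agree near \<open>x\<close> satisfy the same
  \<open>has_derivative\<close> statements, so the choice operator in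
  \<open>frechet_derivative\<close> returns the same value, whether or not a derivative exists. It
  lets a derivative be replaced by a formula known only on \<open>S\<close>.\<close>

lemma dir_deriv_cong:
  assumes "open S" "x \<in> S" "\<And>y. y \<in> S \<Longrightarrow> f y = g y"
  shows "dir_deriv h f x = dir_deriv h g x"
proof -
  have "(f has_derivative f') (at x) \<longleftrightarrow> (g has_derivative f') (at x)" for f'
    using assms has_derivative_transform_within_open[of f f' x UNIV S g]
      has_derivative_transform_within_open[of g f' x UNIV S f] by auto
  then show ?thesis
    unfolding dir_deriv_def frechet_derivative_def by simp
qed

lemma differentiable_cong_open:
  assumes "open S" "x \<in> S" "\<And>y. y \<in> S \<Longrightarrow> f y = g y" "f differentiable (at x)"
  shows "g differentiable (at x)"
  using assms has_derivative_transform_within_open[of f _ x UNIV S g]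
  unfolding differentiable_def by blast

section \<open>Closure of k times differentiable functions under algebraic operations and
  composition\<close>

lemma Ck_on_Suc:
  "Ck_on (Suc k) S f \<longleftrightarrow> (\<forall>x\<in>S. f differentiable (at x)) \<and> (\<forall>h. Ck_on k S (dir_deriv h f))"
proof -
  have "dir_deriv h f = (\<lambda>x. frechet_derivative f (at x) h)" for h
    by (rule ext) (simp add: dir_deriv_def)
  then show ?thesis by simp
qed

declare Ck_on.simps(2)[simp del]

lemma Ck_on_cong:
  assumes "open S" "\<And>x. x \<in> S \<Longrightarrow> f x = g x" "Ck_on k S f"
  shows "Ck_on k S g"
  using assms(2,3)
proof (induction k arbitrary: f g)
  case 0
  then show ?case by (simp cong: continuous_on_cong)
next
  case (Suc k)
  have "Ck_on k S (dir_deriv h g)" for h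
  proof (rule Suc.IH)
    show "Ck_on k S (dir_deriv h f)"
      using Suc.prems(2) by (simp add: Ck_on_Suc)
  qed (rule dir_deriv_cong[OF assms(1) _ Suc.prems(1)])
  then show ?case
    using Suc.prems differentiable_cong_open[OF assms(1), of _ f g] by (auto simp: Ck_on_Suc)
qed

lemma Ck_on_SucD: "Ck_on (Suc k) S f \<Longrightarrow> Ck_on k S f"
proof (induction k arbitrary: f)
  case 0
  then show ?case
    by (auto simp: Ck_on_Suc intro!: continuous_at_imp_continuous_on differentiable_imp_continuous_within)
next
  case (Suc k)
  then show ?case by (meson Ck_on_Suc)
qed

lemma Ck_on_subset: "Ck_on k S f \<Longrightarrow> T \<subseteq> S \<Longrightarrow> Ck_on k T f"
  by (induction k arbitrary: f) (auto simp: Ck_on_Suc intro: continuous_on_subset)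

text \<open>Derivatives are usually known through a formula valid on \<open>S\<close> only, while
  \<open>Ck_on\<close> speaks of \<open>frechet_derivative\<close>; \<open>Ck_on_cong\<close> passes
  from one to the other.\<close>

lemma Ck_on_SucI:
  assumes "open S" "\<And>x. x \<in> S \<Longrightarrow> (f has_derivative f' x) (at x)" "\<And>h. Ck_on k S (\<lambda>x. f' x h)"
  shows "Ck_on (Suc k) S f"
proof -
  have "Ck_on k S (dir_deriv h f)" for h
    by (rule Ck_on_cong[OF assms(1) _ assms(3)]) (simp add: dir_deriv_eq[OF assms(2)])
  then show ?thesis
    using assms(2) by (auto simp: Ck_on_Suc differentiable_def)
qed

lemma Ck_on_Suc_has_derivative:
  "Ck_on (Suc k) S f \<Longrightarrow> x \<in> S \<Longrightarrow> (f has_derivative (\<lambda>h. dir_deriv h f x)) (at x)"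
  by (simp add: Ck_on_Suc has_derivative_dir_deriv)

lemma Ck_on_Suc_dir_deriv: "Ck_on (Suc k) S f \<Longrightarrow> Ck_on k S (dir_deriv h f)"
  by (simp add: Ck_on_Suc)

lemma Ck_on_const: "open S \<Longrightarrow> Ck_on k S (\<lambda>_. c)"
proof (induction k arbitrary: c)
  case (Suc k)
  show ?case by (rule Ck_on_SucI[OF Suc.prems has_derivative_const Suc.IH[OF Suc.prems]])
qed simp

lemma Ck_on_bounded_linear:
  assumes L: "bounded_linear L" and "open S" "Ck_on k S f"
  shows "Ck_on k S (\<lambda>x. L (f x))"
  using assms(3)
proof (induction k arbitrary: f)
  case 0
  then show ?case by (auto intro: bounded_linear.continuous_on[OF L])
next
  case (Suc k)
  show ?case
    by (rule Ck_on_SucI[OF \<open>open S\<close> bounded_linear.has_derivative[OF L Ck_on_Suc_has_derivative[OF Suc.prems]]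
          Suc.IH[OF Ck_on_Suc_dir_deriv[OF Suc.prems]]])
qed

lemma Ck_on_linear:
  assumes L: "bounded_linear L" and "open S"
  shows "Ck_on k S L"
proof (cases k)
  case 0
  then show ?thesis by (auto intro!: linear_continuous_on L)
next
  case (Suc l)
  then show ?thesis
    using Ck_on_SucI[OF \<open>open S\<close> bounded_linear_imp_has_derivative[OF L] Ck_on_const[OF \<open>open S\<close>]]
    by simp
qed

lemma Ck_on_add:
  assumes "open S" "Ck_on k S f" "Ck_on k S g"
  shows "Ck_on k S (\<lambda>x. f x + g x)"
  using assms(2,3)
proof (induction k arbitrary: f g)
  case 0
  then show ?case by (auto intro: continuous_intros)
next
  case (Suc k)
  show ?case
    by (rule Ck_on_SucI[OF \<open>open S\<close> has_derivative_add[OF Suc.prems[THEN Ck_on_Suc_has_derivative]]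
          Suc.IH[OF Suc.prems[THEN Ck_on_Suc_dir_deriv]]])
qed

lemma Ck_on_scaleR:
  assumes "open S" "Ck_on k S f" "Ck_on k S g"
  shows "Ck_on k S (\<lambda>x. f x *\<^sub>R g x)"
  using assms(2,3)
proof (induction k arbitrary: f g)
  case 0
  then show ?case by (auto intro: continuous_intros)
next
  case (Suc k)
  note D = Suc.prems[THEN Ck_on_Suc_has_derivative] Suc.prems[THEN Ck_on_Suc_dir_deriv]
    Suc.prems[THEN Ck_on_SucD]
  show ?case
    by (rule Ck_on_SucI[OF \<open>open S\<close> has_derivative_scaleR[OF D(1,2)]
          Ck_on_add[OF \<open>open S\<close> Suc.IH[OF D(5,4)] Suc.IH[OF D(3,6)]]])
qed

lemma Ck_on_sum:
  assumes "open S" "\<And>i. i \<in> I \<Longrightarrow> Ck_on k S (f i)"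
  shows "Ck_on k S (\<lambda>x. \<Sum>i\<in>I. f i x)"
  using assms(2)
  by (induction I rule: infinite_finite_induct) (auto intro: Ck_on_add[OF assms(1)] Ck_on_const[OF assms(1)])

lemma Ck_on_inverse:
  fixes f :: "'a::real_normed_vector \<Rightarrow> real"
  assumes "open S" "\<And>x. x \<in> S \<Longrightarrow> f x \<noteq> 0" "Ck_on k S f"
  shows "Ck_on k S (\<lambda>x. inverse (f x))"
  using assms(3)
proof (induction k)
  case 0
  then show ?case using assms(2) by (auto intro: continuous_intros)
next
  case (Suc k)
  \<comment> \<open>The derivative of \<open>1/f\<close> contains \<open>1/f\<close> itself, now at
    the lower order \<open>k\<close> of the induction hypothesis. It is written with
    \<open>*\<^sub>R\<close> throughout so that \<open>Ck_on_scaleR\<close> reaches every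
    factor.\<close>
  have "((\<lambda>x. inverse (f x)) has_derivative
      (\<lambda>h. - 1 *\<^sub>R (inverse (f x) *\<^sub>R (dir_deriv h f x *\<^sub>R inverse (f x))))) (at x)" if "x \<in> S" for x
    using Deriv.has_derivative_inverse[OF assms(2)[OF that] Ck_on_Suc_has_derivative[OF Suc.prems that]]
    by (simp add: mult.assoc)
  moreover have "Ck_on k S (\<lambda>x. - 1 *\<^sub>R (inverse (f x) *\<^sub>R (dir_deriv h f x *\<^sub>R inverse (f x))))" for h
    using Suc Ck_on_SucD[OF Suc.prems]
    by (intro Ck_on_scaleR[OF \<open>open S\<close>] Ck_on_const[OF \<open>open S\<close>] Ck_on_Suc_dir_deriv) auto
  ultimately show ?case by (rule Ck_on_SucI[OF \<open>open S\<close>])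
qed

lemma dir_deriv_sum_Basis:
  fixes f :: "'a::euclidean_space \<Rightarrow> 'b::real_normed_vector"
  assumes "f differentiable (at x)"
  shows "dir_deriv h f x = (\<Sum>b\<in>Basis. (h \<bullet> b) *\<^sub>R dir_deriv b f x)"
proof -
  interpret bounded_linear "\<lambda>h. dir_deriv h f x"
    using has_derivative_dir_deriv[OF assms] has_derivative_bounded_linear by blast
  have "dir_deriv h f x = dir_deriv (\<Sum>b\<in>Basis. (h \<bullet> b) *\<^sub>R b) f x"
    by (simp only: euclidean_representation)
  then show ?thesis by (simp only: sum scaleR)
qed

text \<open>In the chain rule the direction in which \<open>f\<close> is differentiated moves with
  \<open>x\<close>. Expanding it in a basis leaves fixed directions \<open>b\<close>, so the
  induction hypothesis applies to \<open>dir_deriv b f\<close>; this is why the intermediate space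
  is Euclidean.\<close>

lemma Ck_on_compose:
  fixes g :: "'a::real_normed_vector \<Rightarrow> 'b::euclidean_space"
    and f :: "'b \<Rightarrow> 'c::real_normed_vector"
  assumes "open S" "g ` S \<subseteq> T" "Ck_on k S g" "Ck_on k T f"
  shows "Ck_on k S (\<lambda>x. f (g x))"
  using assms(3,4)
proof (induction k arbitrary: f)
  case 0
  then show ?case using assms(2) by (auto intro: continuous_on_compose2)
next
  case (Suc k)
  have g: "g x \<in> T" if "x \<in> S" for x
    using assms(2) that by auto
  have df: "f differentiable (at (g x))" if "x \<in> S" for x
    using Suc.prems(2) g[OF that] by (simp add: Ck_on_Suc)
  have "((\<lambda>x. f (g x)) has_derivative (\<lambda>h. \<Sum>b\<in>Basis. (dir_deriv h g x \<bullet> b) *\<^sub>R dir_deriv b f (g x))) (at x)"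
    if "x \<in> S" for x
    using has_derivative_compose[OF Ck_on_Suc_has_derivative[OF Suc.prems(1) that]
        has_derivative_dir_deriv[OF df[OF that]]]
    by (subst (asm) dir_deriv_sum_Basis[OF df[OF that]])
  moreover have "Ck_on k S (\<lambda>x. \<Sum>b\<in>Basis. (dir_deriv h g x \<bullet> b) *\<^sub>R dir_deriv b f (g x))" for h
    by (intro Ck_on_sum Ck_on_scaleR \<open>open S\<close> Suc.IH Suc.prems[THEN Ck_on_SucD] Suc.prems[THEN Ck_on_Suc_dir_deriv]
         Ck_on_bounded_linear[of "\<lambda>y. y \<bullet> _", OF bounded_linear_inner_left])
  ultimately show ?case by (rule Ck_on_SucI[OF \<open>open S\<close>])
qed

section \<open>Smooth functions\<close>

lemma smooth_on_differentiable: "smooth_on S f \<Longrightarrow> x \<in> S \<Longrightarrow> f differentiable (at x)"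
  by (metis Ck_on_Suc smooth_on_def)

lemma smooth_on_has_derivative:
  "smooth_on S f \<Longrightarrow> x \<in> S \<Longrightarrow> (f has_derivative (\<lambda>h. dir_deriv h f x)) (at x)"
  by (simp add: has_derivative_dir_deriv smooth_on_differentiable)

lemma smooth_on_dir_deriv: "smooth_on S f \<Longrightarrow> smooth_on S (dir_deriv h f)"
  by (metis Ck_on_Suc smooth_on_def)

lemma smooth_on_continuous_on: "smooth_on S f \<Longrightarrow> continuous_on S f"
  using Ck_on.simps(1) smooth_on_def by blast

lemma smooth_on_subset: "smooth_on S f \<Longrightarrow> T \<subseteq> S \<Longrightarrow> smooth_on T f"
  by (meson Ck_on_subset smooth_on_def)

lemma smooth_on_const: "open S \<Longrightarrow> smooth_on S (\<lambda>_. c)"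
  by (simp add: smooth_on_def Ck_on_const)

lemma smooth_on_linear: "bounded_linear L \<Longrightarrow> open S \<Longrightarrow> smooth_on S L"
  by (simp add: smooth_on_def Ck_on_linear)

lemma smooth_on_bounded_linear:
  "bounded_linear L \<Longrightarrow> open S \<Longrightarrow> smooth_on S f \<Longrightarrow> smooth_on S (\<lambda>x. L (f x))"
  by (simp add: smooth_on_def Ck_on_bounded_linear)

lemma smooth_on_add:
  "open S \<Longrightarrow> smooth_on S f \<Longrightarrow> smooth_on S g \<Longrightarrow> smooth_on S (\<lambda>x. f x + g x)"
  by (simp add: smooth_on_def Ck_on_add)

lemma smooth_on_mult:
  fixes f g :: "'a::real_normed_vector \<Rightarrow> real"
  shows "open S \<Longrightarrow> smooth_on S f \<Longrightarrow> smooth_on S g \<Longrightarrow> smooth_on S (\<lambda>x. f x * g x)"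
  using Ck_on_scaleR[of S _ f g] by (simp add: smooth_on_def)

lemma smooth_on_diff:
  fixes f g :: "'a::real_normed_vector \<Rightarrow> real"
  shows "open S \<Longrightarrow> smooth_on S f \<Longrightarrow> smooth_on S g \<Longrightarrow> smooth_on S (\<lambda>x. f x - g x)"
  using smooth_on_add[of S f "\<lambda>x. (-1) * g x"] smooth_on_mult[OF _ smooth_on_const, of S g "-1"] by simp

lemma smooth_on_divide:
  fixes f g :: "'a::real_normed_vector \<Rightarrow> real"
  shows "open S \<Longrightarrow> smooth_on S f \<Longrightarrow> smooth_on S g \<Longrightarrow> (\<And>x. x \<in> S \<Longrightarrow> g x \<noteq> 0)
    \<Longrightarrow> smooth_on S (\<lambda>x. f x / g x)"
  unfolding divide_inverse
  by (rule smooth_on_mult) (auto simp: smooth_on_def Ck_on_inverse)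

lemma smooth_on_Pair:
  assumes "open S" "smooth_on S f" "smooth_on S g"
  shows "smooth_on S (\<lambda>x. (f x, g x))"
  using smooth_on_add[OF assms(1) smooth_on_bounded_linear[OF _ assms(1,2), of "\<lambda>y. (y, 0)"]
      smooth_on_bounded_linear[OF _ assms(1,3), of "\<lambda>y. (0, y)"]]
  by (simp add: bounded_linear_Pair bounded_linear_zero bounded_linear_ident)

lemma smooth_on_compose:
  fixes g :: "'a::real_normed_vector \<Rightarrow> 'b::euclidean_space"
  shows "open S \<Longrightarrow> g ` S \<subseteq> T \<Longrightarrow> smooth_on S g \<Longrightarrow> smooth_on T f \<Longrightarrow> smooth_on S (\<lambda>x. f (g x))"
  by (simp add: smooth_on_def Ck_on_compose)

lemmas smooth_on_fst = smooth_on_bounded_linear[OF bounded_linear_fst]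
lemmas smooth_on_snd = smooth_on_bounded_linear[OF bounded_linear_snd]
lemmas smooth_on_ident = smooth_on_linear[OF bounded_linear_ident]

section \<open>Derivatives along curves and symmetry of second derivatives\<close>

lemma dir_deriv_linear:
  assumes "f differentiable (at x)"
  shows "linear (\<lambda>h. dir_deriv h f x)"
  using has_derivative_dir_deriv[OF assms] has_derivative_linear by blast

lemma dir_deriv_along_curve:
  fixes c :: "real \<Rightarrow> 'a::real_normed_vector" and F :: "'a \<Rightarrow> real"
  assumes "F differentiable (at (c s))" "(c has_vector_derivative c') (at s)"
  shows "((\<lambda>s. F (c s)) has_real_derivative dir_deriv c' F (c s)) (at s)"
proof -
  have "((\<lambda>s. F (c s)) has_derivative (\<lambda>r. dir_deriv (r *\<^sub>R c') F (c s))) (at s)"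
    using assms(2) unfolding has_vector_derivative_def
    by (rule has_derivative_compose[of c _ s UNIV F, OF _ has_derivative_dir_deriv[OF assms(1)]])
  then show ?thesis
    using linear_cmul[OF dir_deriv_linear[OF assms(1)]]
    by (simp add: has_field_derivative_def mult_commute_abs)
qed

lemma has_real_derivative_along_line:
  fixes F :: "'a::real_normed_vector \<Rightarrow> real"
  assumes "F differentiable (at (p + s *\<^sub>R k))"
  shows "((\<lambda>s. F (p + s *\<^sub>R k)) has_real_derivative dir_deriv k F (p + s *\<^sub>R k)) (at s)"
  by (rule dir_deriv_along_curve[of F "\<lambda>s. p + s *\<^sub>R k", OF assms])
     (auto simp: has_vector_derivative_def intro!: derivative_eq_intros)

text \<open>The mean value theorem is applied twice: in direction \<open>k\<close> to the increment
  of \<open>F\<close> along \<open>h\<close>, and in direction \<open>h\<close> to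
  \<open>dir_deriv k F\<close>.\<close>

lemma second_difference:
  fixes F :: "'a::real_normed_vector \<Rightarrow> real"
  assumes "0 < s"
    and S: "\<And>a b. 0 \<le> a \<Longrightarrow> a \<le> s \<Longrightarrow> 0 \<le> b \<Longrightarrow> b \<le> s \<Longrightarrow> p + a *\<^sub>R h + b *\<^sub>R k \<in> S"
    and F: "\<And>x. x \<in> S \<Longrightarrow> F differentiable (at x)" "\<And>x. x \<in> S \<Longrightarrow> dir_deriv k F differentiable (at x)"
  obtains a b where "0 \<le> a" "a \<le> s" "0 \<le> b" "b \<le> s"
    "F (p + s *\<^sub>R h + s *\<^sub>R k) - F (p + s *\<^sub>R k) - (F (p + s *\<^sub>R h) - F p)
      = s * s * dir_deriv h (dir_deriv k F) (p + a *\<^sub>R h + b *\<^sub>R k)"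
proof -
  define g where "g b = F (p + s *\<^sub>R h + b *\<^sub>R k) - F (p + b *\<^sub>R k)" for b
  have 1: "p + s *\<^sub>R h + b *\<^sub>R k \<in> S" "p + b *\<^sub>R k \<in> S" if "0 \<le> b" "b \<le> s" for b
    using S[of s b] S[of 0 b] that \<open>0 < s\<close> by auto
  have "(g has_real_derivative
      dir_deriv k F (p + s *\<^sub>R h + b *\<^sub>R k) - dir_deriv k F (p + b *\<^sub>R k)) (at b)"
    if "0 \<le> b" "b \<le> s" for b
    unfolding g_def using 1[OF that] F(1)
    by (intro DERIV_diff has_real_derivative_along_line) auto
  from MVT2[OF \<open>0 < s\<close> this] obtain b where b: "0 < b" "b < s"
    "g s - g 0 = s * (dir_deriv k F (p + s *\<^sub>R h + b *\<^sub>R k) - dir_deriv k F (p + b *\<^sub>R k))"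
    by auto
  have "((\<lambda>a. dir_deriv k F ((p + b *\<^sub>R k) + a *\<^sub>R h)) has_real_derivative
      dir_deriv h (dir_deriv k F) ((p + b *\<^sub>R k) + a *\<^sub>R h)) (at a)"
    if "0 \<le> a" "a \<le> s" for a
    using S[of a b] that b F(2) by (intro has_real_derivative_along_line) (auto simp: add.commute add.left_commute)
  from MVT2[OF \<open>0 < s\<close> this] obtain a where a: "0 < a" "a < s"
    "dir_deriv k F (p + b *\<^sub>R k + s *\<^sub>R h) - dir_deriv k F (p + b *\<^sub>R k) =
      s * dir_deriv h (dir_deriv k F) (p + b *\<^sub>R k + a *\<^sub>R h)"
    by auto
  show ?thesis
    using a b by (intro that[of a b]) (auto simp: g_def algebra_simps)
qed

text \<open>The second difference is symmetric in \<open>h\<close> and \<open>k\<close>, so by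
  \<open>second_difference\<close> the two mixed derivatives take equal values at two points
  arbitrarily close to \<open>p\<close>. By continuity they cannot differ at
  \<open>p\<close>.\<close>

lemma dir_deriv_commute:
  fixes F :: "'a::real_normed_vector \<Rightarrow> real"
  assumes "open S" "smooth_on S F" "p \<in> S"
  shows "dir_deriv h (dir_deriv k F) p = dir_deriv k (dir_deriv h F) p"
proof (rule ccontr)
  let ?A = "dir_deriv h (dir_deriv k F)" and ?B = "dir_deriv k (dir_deriv h F)"
  assume ne: "?A p \<noteq> ?B p"
  define e where "e = \<bar>?A p - ?B p\<bar> / 2"
  have e: "0 < e" using ne by (simp add: e_def)
  have cont: "isCont ?A p" "isCont ?B p"
    using assms smooth_on_continuous_on smooth_on_dir_deriv
    by (metis continuous_on_eq_continuous_at)+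
  obtain d1 where d1: "0 < d1" "\<And>y. dist y p < d1 \<Longrightarrow> \<bar>?A y - ?A p\<bar> < e"
    using cont(1) e unfolding continuous_at_eps_delta dist_real_def by blast
  obtain d2 where d2: "0 < d2" "\<And>y. dist y p < d2 \<Longrightarrow> \<bar>?B y - ?B p\<bar> < e"
    using cont(2) e unfolding continuous_at_eps_delta dist_real_def by blast
  obtain d3 where d3: "0 < d3" "ball p d3 \<subseteq> S"
    using assms openE by blast
  define d where "d = min d1 (min d2 d3)"
  have d: "0 < d" using d1 d2 d3 by (simp add: d_def)
  \<comment> \<open>Small enough for the whole parallelogram to lie within distance \<open>d\<close>
    of \<open>p\<close>; the summand 1 keeps the denominator positive when
    \<open>h = k = 0\<close>.\<close>
  define s where "s = d / (2 * (norm h + norm k + 1))"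
  have s: "0 < s" using d by (auto simp: s_def add_nonneg_pos intro!: divide_pos_pos)
  have near: "dist (p + a *\<^sub>R h + b *\<^sub>R k) p < d" if "0 \<le> a" "a \<le> s" "0 \<le> b" "b \<le> s" for a b
  proof -
    have "dist (p + a *\<^sub>R h + b *\<^sub>R k) p \<le> norm (a *\<^sub>R h) + norm (b *\<^sub>R k)"
      by (simp add: dist_norm norm_triangle_ineq add.assoc del: norm_scaleR)
    also have "\<dots> \<le> s * norm h + s * norm k"
      using that by (auto intro!: add_mono mult_right_mono)
    also have "\<dots> < s * (2 * (norm h + norm k + 1))"
      using s by (auto simp: algebra_simps add_pos_nonneg intro!: add_nonneg_pos)
    also have "\<dots> = d"
      using add_nonneg_pos[of "norm h + norm k" 1] unfolding s_def by (intro nonzero_eq_divide_eq[THEN iffD1] refl) auto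
    finally show ?thesis .
  qed
  have S: "p + a *\<^sub>R h + b *\<^sub>R k \<in> S" if "0 \<le> a" "a \<le> s" "0 \<le> b" "b \<le> s" for a b
    using near[OF that] d3 by (auto simp: d_def dist_commute)
  have S': "p + a *\<^sub>R k + b *\<^sub>R h \<in> S" if "0 \<le> a" "a \<le> s" "0 \<le> b" "b \<le> s" for a b
    using S[of b a] that by (simp add: add.commute add.left_commute)
  note diff = smooth_on_differentiable[OF assms(2)] smooth_on_differentiable[OF smooth_on_dir_deriv[OF assms(2)]]
  obtain a b where ab: "0 \<le> a" "a \<le> s" "0 \<le> b" "b \<le> s"
    "F (p + s *\<^sub>R h + s *\<^sub>R k) - F (p + s *\<^sub>R k) - (F (p + s *\<^sub>R h) - F p)
      = s * s * ?A (p + a *\<^sub>R h + b *\<^sub>R k)"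
    using second_difference[of s p h k S F] S s diff by blast
  obtain a' b' where ab': "0 \<le> a'" "a' \<le> s" "0 \<le> b'" "b' \<le> s"
    "F (p + s *\<^sub>R k + s *\<^sub>R h) - F (p + s *\<^sub>R h) - (F (p + s *\<^sub>R k) - F p)
      = s * s * ?B (p + a' *\<^sub>R k + b' *\<^sub>R h)"
    using second_difference[of s p k h S F] S' s diff by blast
  have E: "p + s *\<^sub>R k + s *\<^sub>R h = p + s *\<^sub>R h + s *\<^sub>R k"
    "p + a' *\<^sub>R k + b' *\<^sub>R h = p + b' *\<^sub>R h + a' *\<^sub>R k"
    by (simp_all add: algebra_simps)
  have "s * s * ?A (p + a *\<^sub>R h + b *\<^sub>R k) = s * s * ?B (p + b' *\<^sub>R h + a' *\<^sub>R k)"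
    using ab(5) ab'(5)[unfolded E] by linarith
  moreover have "s * s \<noteq> 0" using s by simp
  ultimately have eq: "?A (p + a *\<^sub>R h + b *\<^sub>R k) = ?B (p + b' *\<^sub>R h + a' *\<^sub>R k)"
    using mult_left_cancel by blast
  have "\<bar>?A (p + a *\<^sub>R h + b *\<^sub>R k) - ?A p\<bar> < e" "\<bar>?B (p + b' *\<^sub>R h + a' *\<^sub>R k) - ?B p\<bar> < e"
    using near[of a b] near[of b' a'] ab ab' d1(2) d2(2) by (auto simp: d_def)
  then show False using eq by (auto simp: e_def abs_if split: if_splits)
qed

text \<open>The direction \<open>c' r\<close> varies with \<open>r\<close>, so it is expanded in a
  basis and the product rule applied to each summand. The first term of the result has its inner
  direction frozen at \<open>s\<close>; the second comes from the acceleration of the curve.\<close>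

lemma second_deriv_along_curve:
  fixes c :: "real \<Rightarrow> 'a::euclidean_space" and F :: "'a \<Rightarrow> real"
  assumes "open S" "smooth_on S F" "c s \<in> S"
    and c: "(c has_vector_derivative c' s) (at s)"
    and c': "(c' has_vector_derivative c'') (at s)"
  shows "((\<lambda>r. dir_deriv (c' r) F (c r)) has_real_derivative
           dir_deriv (c' s) (dir_deriv (c' s) F) (c s) + dir_deriv c'' F (c s)) (at s)"
proof -
  have "isCont c s"
    using c has_vector_derivative_continuous by blast
  then have "eventually (\<lambda>r. c r \<in> S) (nhds s)"
    using assms(1,3) by (simp add: continuous_at topological_tendstoD tendsto_nhds_iff)
  then obtain I where I: "open I" "s \<in> I" "c ` I \<subseteq> S"
    unfolding eventually_nhds by blast
  have F1: "F differentiable (at y)" if "y \<in> S" for y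
    using smooth_on_differentiable assms(2) that by blast
  have F2: "dir_deriv b F differentiable (at y)" if "y \<in> S" for b y
    using smooth_on_differentiable smooth_on_dir_deriv assms(2) that by blast
  have inner: "((\<lambda>r. c' r \<bullet> b) has_real_derivative c'' \<bullet> b) (at s)" for b
    using bounded_linear.has_vector_derivative[OF bounded_linear_inner_left c', of b]
    by (simp add: has_real_derivative_iff_has_vector_derivative)
  have "((\<lambda>r. \<Sum>b\<in>Basis. (c' r \<bullet> b) * dir_deriv b F (c r)) has_real_derivative
      (\<Sum>b\<in>Basis. c'' \<bullet> b * dir_deriv b F (c s) + dir_deriv (c' s) (dir_deriv b F) (c s) * (c' s \<bullet> b))) (at s)"
    by (intro DERIV_sum DERIV_mult inner dir_deriv_along_curve F2 assms(3) c)
  also have "(\<Sum>b\<in>Basis. c'' \<bullet> b * dir_deriv b F (c s) + dir_deriv (c' s) (dir_deriv b F) (c s) * (c' s \<bullet> b))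
      = dir_deriv c'' F (c s) + (\<Sum>b\<in>Basis. (c' s \<bullet> b) * dir_deriv (c' s) (dir_deriv b F) (c s))"
    using dir_deriv_sum_Basis[OF F1[OF assms(3)], of c'']
    by (simp add: sum.distrib mult.commute)
  \<comment> \<open>The coefficients are constants here, frozen at \<open>s\<close>, and may be
    moved inside the outer derivative.\<close>
  also have "(\<Sum>b\<in>Basis. (c' s \<bullet> b) * dir_deriv (c' s) (dir_deriv b F) (c s))
      = dir_deriv (c' s) (\<lambda>y. \<Sum>b\<in>Basis. (c' s \<bullet> b) * dir_deriv b F y) (c s)"
    by (rule dir_deriv_eq[symmetric])
       (auto intro!: derivative_eq_intros has_derivative_dir_deriv F2 assms(3))
  also have "\<dots> = dir_deriv (c' s) (dir_deriv (c' s) F) (c s)"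
    using dir_deriv_sum_Basis[OF F1, of _ "c' s"] by (intro dir_deriv_cong[OF assms(1,3)]) auto
  finally have "((\<lambda>r. \<Sum>b\<in>Basis. (c' r \<bullet> b) * dir_deriv b F (c r)) has_real_derivative
     dir_deriv (c' s) (dir_deriv (c' s) F) (c s) + dir_deriv c'' F (c s)) (at s)"
    by (simp add: add.commute)
  then show ?thesis
    by (rule has_field_derivative_transform_within_open[OF _ I(1,2)])
       (use dir_deriv_sum_Basis[OF F1] I(3) in auto)
qed

subsection \<open>Solutions of the Burgers equation with prescribed jets\<close>

lemma smooth_on_power:
  fixes f :: "'a::real_normed_vector \<Rightarrow> real"
  shows "open S \<Longrightarrow> smooth_on S f \<Longrightarrow> smooth_on S (\<lambda>x. f x ^ n)"
  by (induction n) (simp_all add: smooth_on_const smooth_on_mult)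

lemma deriv_partial_fst:
  fixes f :: "real \<times> real \<Rightarrow> real"
  assumes "f differentiable (at (t, x))"
  shows "deriv (\<lambda>s. f (s, x)) t = dir_deriv (1, 0) f (t, x)"
  by (rule DERIV_imp_deriv, rule dir_deriv_along_curve[of f "\<lambda>s. (s, x)", OF assms])
     (auto simp: has_vector_derivative_def intro!: derivative_eq_intros)

lemma deriv_partial_snd:
  fixes f :: "real \<times> real \<Rightarrow> real"
  assumes "f differentiable (at (t, x))"
  shows "deriv (\<lambda>y. f (t, y)) x = dir_deriv (0, 1) f (t, x)"
  by (rule DERIV_imp_deriv, rule dir_deriv_along_curve[of f "\<lambda>y. (t, y)", OF assms])
     (auto simp: has_vector_derivative_def intro!: derivative_eq_intros)

lemma second_deriv_partial_snd:
  fixes f :: "real \<times> real \<Rightarrow> real"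
  assumes "open D" "smooth_on D f" "(t, x) \<in> D"
  shows "(deriv ^^ 2) (\<lambda>y. f (t, y)) x = dir_deriv (0, 1) (dir_deriv (0, 1) f) (t, x)"
proof -
  have "open (Pair t -` D)"
    using assms(1) by (intro open_vimage continuous_intros)
  then have "eventually (\<lambda>y. (t, y) \<in> D) (nhds x)"
    using assms(3) eventually_nhds_in_open[of "Pair t -` D" x] by simp
  then have "eventually (\<lambda>y. deriv (\<lambda>y. f (t, y)) y = dir_deriv (0, 1) f (t, y)) (nhds x)"
    by (rule eventually_mono) (use smooth_on_differentiable[OF assms(2)] deriv_partial_snd in blast)
  then have "deriv (deriv (\<lambda>y. f (t, y))) x = deriv (\<lambda>y. dir_deriv (0, 1) f (t, y)) x"
    by (rule deriv_cong_ev) simp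
  then show ?thesis
    using deriv_partial_snd[of "dir_deriv (0, 1) f" t x]
      smooth_on_differentiable[OF smooth_on_dir_deriv[OF assms(2)] assms(3)]
    by (simp add: numeral_2_eq_2)
qed

text \<open>Turns the one-variable \<open>deriv\<close> of the definition into directional
  derivatives, which are functions on \<open>D\<close> and can be composed with curves and
  maps.\<close>

lemma burgers_solution_iff:
  "burgers_solution D f \<longleftrightarrow> open D \<and> smooth_on D f \<and>
     (\<forall>q\<in>D. dir_deriv (1, 0) f q + f q * dir_deriv (0, 1) f q
            = dir_deriv (0, 1) (dir_deriv (0, 1) f) q)"
proof (cases "open D \<and> smooth_on D f")
  case True
  then have "deriv (\<lambda>s. f (s, x)) t = dir_deriv (1, 0) f (t, x)"
    "deriv (\<lambda>y. f (t, y)) x = dir_deriv (0, 1) f (t, x)"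
    "(deriv ^^ 2) (\<lambda>y. f (t, y)) x = dir_deriv (0, 1) (dir_deriv (0, 1) f) (t, x)"
    if "(t, x) \<in> D" for t x
    using that deriv_partial_fst deriv_partial_snd second_deriv_partial_snd[of D f t x]
      smooth_on_differentiable by blast+
  with True show ?thesis
    unfolding burgers_solution_def by (auto split: prod.splits)
qed (auto simp: burgers_solution_def)

text \<open>The functions \<open>u1\<close> to \<open>u4\<close> are the successive x-derivatives of
  a solution \<open>u0\<close> of the heat equation. Since a time derivative counts as two
  x-derivatives, the t-derivative of each \<open>ui\<close> is the function two places further
  on.\<close>

lemma cole_hopf:
  fixes u0 :: "real \<times> real \<Rightarrow> real"
  assumes "open D" and ne: "\<And>q. q \<in> D \<Longrightarrow> u0 q \<noteq> 0"
    and smooth: "smooth_on D u0" "smooth_on D u1"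
    and d0: "\<And>q. q \<in> D \<Longrightarrow> (u0 has_derivative (\<lambda>h. fst h * u2 q + snd h * u1 q)) (at q)"
    and d1: "\<And>q. q \<in> D \<Longrightarrow> (u1 has_derivative (\<lambda>h. fst h * u3 q + snd h * u2 q)) (at q)"
    and d2: "\<And>q. q \<in> D \<Longrightarrow> (u2 has_derivative (\<lambda>h. fst h * u4 q + snd h * u3 q)) (at q)"
  defines "f \<equiv> \<lambda>q. - 2 * u1 q / u0 q"
  shows "burgers_solution D f"
    and "\<And>q h. q \<in> D \<Longrightarrow> dir_deriv h f q =
      - 2 * (fst h * (u3 q * u0 q - u1 q * u2 q) + snd h * (u2 q * u0 q - u1 q * u1 q)) / (u0 q * u0 q)"
proof -
  show df: "dir_deriv h f q =
      - 2 * (fst h * (u3 q * u0 q - u1 q * u2 q) + snd h * (u2 q * u0 q - u1 q * u1 q)) / (u0 q * u0 q)"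
    if "q \<in> D" for q h
    unfolding f_def
    by (rule dir_deriv_eq)
       (use ne[OF that] in \<open>auto intro!: derivative_eq_intros d0[OF that] d1[OF that] simp: fun_eq_iff field_simps\<close>)
  have "dir_deriv (0, 1) (dir_deriv (0, 1) f) q = dir_deriv (1, 0) f q + f q * dir_deriv (0, 1) f q"
    if q: "q \<in> D" for q
  proof -
    have "dir_deriv (0, 1) (dir_deriv (0, 1) f) q
        = dir_deriv (0, 1) (\<lambda>q. - 2 * (u2 q * u0 q - u1 q * u1 q) / (u0 q * u0 q)) q"
      by (rule dir_deriv_cong[OF assms(1) q]) (simp add: df)
    also have "\<dots> = - 2 * ((u3 q * u0 q + u2 q * u1 q - 2 * u1 q * u2 q) * u0 q
          - 2 * (u2 q * u0 q - u1 q * u1 q) * u1 q) / (u0 q * u0 q * u0 q)"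
      by (rule trans[OF dir_deriv_eq])
         (use ne[OF q] in \<open>auto intro!: derivative_eq_intros d0[OF q] d1[OF q] d2[OF q] simp: field_simps\<close>)
    also have "\<dots> = dir_deriv (1, 0) f q + f q * dir_deriv (0, 1) f q"
      unfolding df[OF q] unfolding f_def using ne[OF q] by (simp add: field_simps)
    finally show ?thesis .
  qed
  moreover have "smooth_on D f"
    unfolding f_def using assms(1) smooth ne
    by (intro smooth_on_divide smooth_on_mult smooth_on_const)
  ultimately show "burgers_solution D f"
    using assms(1) by (simp add: burgers_solution_iff)
qed

text \<open>
  The solutions come from heat polynomials of degree 5. The value \<open>M\<close> of \<open>f\<^sub>t\<^sub>t\<close> is independent of
  \<open>v\<close>, \<open>P\<close>, \<open>R\<close> because it contains \<open>f\<^sub>x\<^sub>x\<^sub>x\<^sub>x\<close>; \<open>K\<close> is the mixed derivative, which need not be prescribed.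
\<close>

lemma burgers_solution_with_jet:
  "\<exists>K. \<forall>M. \<exists>D f. burgers_solution D f \<and> (t, x) \<in> D \<and> f (t, x) = v \<and>
     dir_deriv (0, 1) f (t, x) = P \<and> dir_deriv (1, 0) f (t, x) = R - v * P \<and>
     (\<forall>\<xi>. dir_deriv \<xi> (dir_deriv \<xi> f) (t, x)
        = M * (fst \<xi>)\<^sup>2 + 2 * K * fst \<xi> * snd \<xi> + R * (snd \<xi>)\<^sup>2)"
proof -
  \<comment> \<open>\<open>c1\<close>, \<open>c2\<close>, \<open>c3\<close> are the x-derivatives of
    the heat solution at \<open>(t, x)\<close>, where its value is 1. They solve
    \<open>- 2 * c1 = v\<close>, \<open>- 2 * (c2 - c1 * c1) = P\<close> and
    \<open>- 2 * (c3 - c1 * c2) = R - v * P\<close>.\<close>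
  define c1 where "c1 = - v / 2"
  define c2 where "c2 = c1 * c1 - P / 2"
  define c3 where "c3 = c1 * c2 - (R - v * P) / 2"
  show ?thesis
  \<comment> \<open>This is \<open>f_tx\<close> computed by the Cole-Hopf formula with fourth
    derivative \<open>c4 = 0\<close>. It does not contain the fifth derivative \<open>c5\<close>,
    the only constant that depends on \<open>M\<close>, so one \<open>K\<close> serves all
    \<open>M\<close>.\<close>
  proof (intro exI[of _ "2 * (c2 * c2 + 2 * c1 * c3 - 2 * c1 * c1 * c2)"] allI)
    fix M
    \<comment> \<open>Solves \<open>f_tt = M\<close>, since at the point
      \<open>f_tt = - 2 * (c5 - 2 * (c3 - c1 * c2) * c2)\<close>.\<close>
    define c5 where "c5 = - M / 2 + 2 * (c3 - c1 * c2) * c2"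
    \<comment> \<open>\<open>u0\<close> is the sum of the heat polynomials centred at
      \<open>(t, x)\<close>, normalized so that the n-th has n-th x-derivative 1 there. The
      polynomial of degree 4 is left out, which sets \<open>c4 = 0\<close>.\<close>
    define u4 where "u4 q = c5 * (snd q - x)" for q :: "real \<times> real"
    define u3 where "u3 q = c3 + c5 * ((snd q - x)^2 / 2 + (fst q - t))" for q :: "real \<times> real"
    define u2 where "u2 q = c2 + c3 * (snd q - x) + c5 * ((snd q - x)^3 / 6 + (fst q - t) * (snd q - x))"
      for q :: "real \<times> real"
    define u1 where "u1 q = c1 + c2 * (snd q - x) + c3 * ((snd q - x)^2 / 2 + (fst q - t))
      + c5 * ((snd q - x)^4 / 24 + (fst q - t) * (snd q - x)^2 / 2 + (fst q - t)^2 / 2)"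
      for q :: "real \<times> real"
    define u0 where "u0 q = 1 + c1 * (snd q - x) + c2 * ((snd q - x)^2 / 2 + (fst q - t))
      + c3 * ((snd q - x)^3 / 6 + (fst q - t) * (snd q - x))
      + c5 * ((snd q - x)^5 / 120 + (fst q - t) * (snd q - x)^3 / 6 + (fst q - t)^2 * (snd q - x) / 2)"
      for q :: "real \<times> real"
    define D where "D = {q. u0 q \<noteq> 0}"
    define f where "f q = - 2 * u1 q / u0 q" for q
    have d0: "(u0 has_derivative (\<lambda>h. fst h * u2 q + snd h * u1 q)) (at q)" for q
      unfolding u0_def u1_def u2_def
      by (auto intro!: derivative_eq_intros simp: fun_eq_iff field_simps power_numeral_reduce)
    have d1: "(u1 has_derivative (\<lambda>h. fst h * u3 q + snd h * u2 q)) (at q)" for q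
      unfolding u1_def u2_def u3_def
      by (auto intro!: derivative_eq_intros simp: fun_eq_iff field_simps power_numeral_reduce)
    have d2: "(u2 has_derivative (\<lambda>h. fst h * u4 q + snd h * u3 q)) (at q)" for q
      unfolding u2_def u3_def u4_def
      by (auto intro!: derivative_eq_intros simp: fun_eq_iff field_simps power_numeral_reduce)
    have d3: "(u3 has_derivative (\<lambda>h. fst h * c5 + snd h * u4 q)) (at q)" for q
      unfolding u3_def u4_def
      by (auto intro!: derivative_eq_intros simp: fun_eq_iff field_simps power_numeral_reduce)
    have "continuous_on UNIV u0"
      unfolding u0_def by (intro continuous_intros) auto
    then have "open D"
      unfolding D_def by (intro open_Collect_neq continuous_intros)
    have lin: "smooth_on D (\<lambda>q. fst q - t)" "smooth_on D (\<lambda>q. snd q - x)"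
      using \<open>open D\<close>
      by (intro smooth_on_diff smooth_on_const smooth_on_linear bounded_linear_fst bounded_linear_snd; simp)+
    have sm: "smooth_on D u0" "smooth_on D u1"
      unfolding u0_def u1_def
      by (intro smooth_on_add smooth_on_mult smooth_on_divide smooth_on_power smooth_on_const lin \<open>open D\<close>; simp)+
    have sol: "burgers_solution D f"
      and df: "\<And>q h. q \<in> D \<Longrightarrow> dir_deriv h f q =
         - 2 * (fst h * (u3 q * u0 q - u1 q * u2 q) + snd h * (u2 q * u0 q - u1 q * u1 q)) / (u0 q * u0 q)"
      unfolding f_def using cole_hopf[OF \<open>open D\<close> _ sm d0 d1 d2] by (auto simp: D_def)
    have vals: "u0 (t, x) = 1" "u1 (t, x) = c1" "u2 (t, x) = c2" "u3 (t, x) = c3" "u4 (t, x) = 0"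
      by (simp_all add: u0_def u1_def u2_def u3_def u4_def)
    have q: "(t, x) \<in> D"
      by (simp add: D_def vals)
    have "dir_deriv \<xi> (dir_deriv \<xi> f) (t, x) = M * (fst \<xi>)\<^sup>2
        + 2 * (2 * (c2 * c2 + 2 * c1 * c3 - 2 * c1 * c1 * c2)) * fst \<xi> * snd \<xi> + R * (snd \<xi>)\<^sup>2" for \<xi>
    proof -
      have "dir_deriv \<xi> (dir_deriv \<xi> f) (t, x) = dir_deriv \<xi> (\<lambda>q. - 2 * (fst \<xi> * (u3 q * u0 q - u1 q * u2 q)
          + snd \<xi> * (u2 q * u0 q - u1 q * u1 q)) / (u0 q * u0 q)) (t, x)"
        by (rule dir_deriv_cong[OF \<open>open D\<close> q df])
      also have "\<dots> = M * (fst \<xi>)\<^sup>2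
        + 2 * (2 * (c2 * c2 + 2 * c1 * c3 - 2 * c1 * c1 * c2)) * fst \<xi> * snd \<xi> + R * (snd \<xi>)\<^sup>2"
        by (rule trans[OF dir_deriv_eq])
           (auto intro!: derivative_eq_intros d0 d1 d2 d3 simp: vals
              c5_def c3_def c2_def c1_def field_simps power2_eq_square)
      finally show ?thesis .
    qed
    moreover have "f (t, x) = v" "dir_deriv (0, 1) f (t, x) = P" "dir_deriv (1, 0) f (t, x) = R - v * P"
      by (simp_all add: df[OF q] vals f_def c1_def c2_def c3_def field_simps)
    ultimately show "\<exists>D f. burgers_solution D f \<and> (t, x) \<in> D \<and> f (t, x) = v \<and>
       dir_deriv (0, 1) f (t, x) = P \<and> dir_deriv (1, 0) f (t, x) = R - v * P \<and>
       (\<forall>\<xi>. dir_deriv \<xi> (dir_deriv \<xi> f) (t, x) = M * (fst \<xi>)\<^sup>2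
          + 2 * (2 * (c2 * c2 + 2 * c1 * c3 - 2 * c1 * c1 * c2)) * fst \<xi> * snd \<xi> + R * (snd \<xi>)\<^sup>2)"
      using sol q by blast
  qed
qed

subsection \<open>The Burgers equation for the transformed function\<close>

lemma dir_deriv_pair:
  fixes F :: "real \<times> real \<Rightarrow> 'b::real_normed_vector"
  assumes "F differentiable (at p)"
  shows "dir_deriv (a, b) F p = a *\<^sub>R dir_deriv (1, 0) F p + b *\<^sub>R dir_deriv (0, 1) F p"
proof -
  have "(a, b) = a *\<^sub>R (1, 0) + b *\<^sub>R (0, 1 :: real)" by simp
  then have "dir_deriv (a, b) F p = dir_deriv (a *\<^sub>R (1, 0) + b *\<^sub>R (0, 1)) F p"
    by (rule arg_cong)
  then show ?thesis
    by (simp only: linear_add[OF dir_deriv_linear[OF assms]] linear_cmul[OF dir_deriv_linear[OF assms]])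
qed

lemma dir_deriv_triple:
  fixes F :: "real \<times> real \<times> real \<Rightarrow> 'b::real_normed_vector"
  assumes "F differentiable (at p)"
  shows "dir_deriv (a, b, c) F p =
    a *\<^sub>R dir_deriv (1, 0, 0) F p + b *\<^sub>R dir_deriv (0, 1, 0) F p + c *\<^sub>R dir_deriv (0, 0, 1) F p"
proof -
  have "(a, b, c) = a *\<^sub>R (1, 0, 0) + b *\<^sub>R (0, 1, 0) + c *\<^sub>R (0, 0, 1 :: real)" by simp
  then have "dir_deriv (a, b, c) F p = dir_deriv (a *\<^sub>R (1, 0, 0) + b *\<^sub>R (0, 1, 0) + c *\<^sub>R (0, 0, 1)) F p"
    by (rule arg_cong)
  then show ?thesis
    by (simp only: linear_add[OF dir_deriv_linear[OF assms]] linear_cmul[OF dir_deriv_linear[OF assms]])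
qed

lemma second_dir_deriv_scaleR:
  fixes F :: "'a::real_normed_vector \<Rightarrow> real"
  assumes "open S" "smooth_on S F" "p \<in> S"
  shows "dir_deriv (a *\<^sub>R h) (dir_deriv (a *\<^sub>R h) F) p = a\<^sup>2 * dir_deriv h (dir_deriv h F) p"
proof -
  note lin = linear_cmul[OF dir_deriv_linear[OF smooth_on_differentiable]]
  have d: "(dir_deriv h F has_derivative (\<lambda>k. dir_deriv k (dir_deriv h F) p)) (at p)"
    using smooth_on_has_derivative[OF smooth_on_dir_deriv[OF assms(2)] assms(3)] .
  have "dir_deriv (a *\<^sub>R h) (dir_deriv (a *\<^sub>R h) F) p = dir_deriv (a *\<^sub>R h) (\<lambda>x. a * dir_deriv h F x) p"
    by (rule dir_deriv_cong[OF assms(1,3)]) (simp add: lin[OF assms(2)])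
  also have "\<dots> = a * dir_deriv (a *\<^sub>R h) (dir_deriv h F) p"
    by (rule dir_deriv_eq[OF has_derivative_mult_right[OF d]])
  also have "\<dots> = a\<^sup>2 * dir_deriv h (dir_deriv h F) p"
    by (simp add: lin[OF smooth_on_dir_deriv[OF assms(2)] assms(3)] power2_eq_square)
  finally show ?thesis .
qed

text \<open>On the open image \<open>\<Phi> \<circ> \<Psi>\<close> is the identity, and
  differentiating it shows that the derivative of \<open>\<Phi>\<close> is onto. In this form the
  hypothesis later yields a nonzero Jacobian.\<close>

lemma local_diffeomorphism_on_nhd:
  assumes "local_diffeomorphism_on U \<Phi>" "p \<in> U"
  obtains e where "0 < e" "ball p e \<subseteq> U" "smooth_on (ball p e) \<Phi>"
    "\<And>q y. q \<in> ball p e \<Longrightarrow> \<exists>n. dir_deriv n \<Phi> q = y"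
proof -
  obtain N \<Psi> where N: "open N" "p \<in> N" "N \<subseteq> U" "open (\<Phi> ` N)" "smooth_on N \<Phi>"
    "smooth_on (\<Phi> ` N) \<Psi>" "\<And>q. q \<in> N \<Longrightarrow> \<Psi> (\<Phi> q) = q"
    using assms unfolding local_diffeomorphism_on_def by blast
  obtain e where e: "0 < e" "ball p e \<subseteq> N"
    using N(1,2) openE by blast
  have "\<exists>n. dir_deriv n \<Phi> q = y" if "q \<in> N" for q y
  proof -
    have im: "\<Phi> q \<in> \<Phi> ` N" using that by blast
    have "(\<Phi> has_derivative (\<lambda>h. dir_deriv h \<Phi> (\<Psi> (\<Phi> q)))) (at (\<Psi> (\<Phi> q)))"
      using smooth_on_has_derivative[OF N(5) that] N(7)[OF that] by simp
    from has_derivative_compose[of \<Psi> _ "\<Phi> q" UNIV \<Phi>, OF smooth_on_has_derivative[OF N(6) im] this]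
    have "((\<lambda>z. \<Phi> (\<Psi> z)) has_derivative (\<lambda>h. dir_deriv (dir_deriv h \<Psi> (\<Phi> q)) \<Phi> q)) (at (\<Phi> q))"
      using N(7)[OF that] by simp
    moreover have "((\<lambda>z. \<Phi> (\<Psi> z)) has_derivative (\<lambda>h. h)) (at (\<Phi> q))"
      by (rule has_derivative_transform_within_open[OF has_derivative_ident N(4) im]) (use N(7) in auto)
    ultimately have "(\<lambda>h. dir_deriv (dir_deriv h \<Psi> (\<Phi> q)) \<Phi> q) = (\<lambda>h. h)"
      using has_derivative_unique by blast
    then show ?thesis by metis
  qed
  with e N that show ?thesis
    by (meson order_trans smooth_on_subset subsetD)
qed

lemma has_derivative_graph_point:
  assumes "f differentiable (at q)"
  shows "(graph_point f has_derivative (\<lambda>h. (fst h, snd h, dir_deriv h f q))) (at q)"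
proof -
  have "graph_point f = (\<lambda>q. (fst q, snd q, f q))"
    by (rule ext) (simp add: graph_point_def)
  then show ?thesis
    using has_derivative_dir_deriv[OF assms] by (auto intro!: derivative_eq_intros)
qed

text \<open>
  Obtained by differentiating \<open>g (T, X) = V\<close> twice along the line in direction \<open>(- D\<^sub>x T, D\<^sub>t T)\<close>,
  along which the derivative of \<open>T\<close> vanishes, so that only the second derivative \<open>g\<^sub>x\<^sub>x\<close> contributes.
\<close>

lemma point_symmetry_identity:
  fixes T X V :: "real \<times> real \<times> real \<Rightarrow> real"
  assumes sym: "burgers_point_symmetry U (\<lambda>q. (T q, X q, V q))"
    and B: "open B" "B \<subseteq> U" "smooth_on B T" "smooth_on B X" "smooth_on B V"
    and f: "burgers_solution D f" "q \<in> D" "p = graph_point f q" "p \<in> B"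
  defines "kt \<equiv> (1, 0, dir_deriv (1, 0) f q)" and "kx \<equiv> (0, 1, dir_deriv (0, 1) f q)"
  assumes at: "at' = dir_deriv kt T p" and ax: "ax = dir_deriv kx T p"
    and bt: "bt = dir_deriv kt X p" and bx: "bx = dir_deriv kx X p"
    and wt: "wt = dir_deriv kt V p" and wx: "wx = dir_deriv kx V p"
    and \<Delta>: "\<Delta> = at' * bx - ax * bt" "\<Delta> \<noteq> 0"
    and k: "k = at' *\<^sub>R kx - ax *\<^sub>R kt"
    and r: "r = dir_deriv (- ax, at') (dir_deriv (- ax, at') f) q"
  shows "\<Delta> * (dir_deriv k (dir_deriv k V) p + r * dir_deriv (0, 0, 1) V p)
    = \<Delta>\<^sup>2 * ((bx * wt - bt * wx) + V p * (at' * wx - ax * wt))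
      + (bx * wt - bt * wx) * (dir_deriv k (dir_deriv k T) p + r * dir_deriv (0, 0, 1) T p)
      + (at' * wx - ax * wt) * (dir_deriv k (dir_deriv k X) p + r * dir_deriv (0, 0, 1) X p)"
proof -
  have D: "open D" "smooth_on D f"
    using f(1) by (auto simp: burgers_solution_iff)
  let ?G = "graph_point f"
  \<comment> \<open>\<open>kt\<close> and \<open>kx\<close> are the tangent vectors of the graph
    over the t- and x-directions. Hence \<open>at'\<close>, \<open>bt\<close>, \<open>wt\<close> and
    \<open>ax\<close>, \<open>bx\<close>, \<open>wx\<close> are the total t- and x-derivatives of
    \<open>T\<close>, \<open>X\<close>, \<open>V\<close> along the graph.\<close>
  have dG: "(?G has_derivative (\<lambda>h. fst h *\<^sub>R kt + snd h *\<^sub>R kx)) (at q)"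
  proof -
    have "(fst h, snd h, dir_deriv h f q) = fst h *\<^sub>R kt + snd h *\<^sub>R kx" for h
      using dir_deriv_pair[OF smooth_on_differentiable[OF D(2) f(2)], of "fst h" "snd h"]
      by (simp add: kt_def kx_def)
    then show ?thesis
      using has_derivative_graph_point[OF smooth_on_differentiable[OF D(2) f(2)]] by simp
  qed
  have dFG: "((\<lambda>r. F (?G r)) has_derivative
      (\<lambda>h. fst h * dir_deriv kt F p + snd h * dir_deriv kx F p)) (at q)"
    if "smooth_on B F" for F :: "real \<times> real \<times> real \<Rightarrow> real"
  proof -
    have F: "F differentiable (at p)" using smooth_on_differentiable that f(4) by blast
    have "((\<lambda>r. F (?G r)) has_derivative (\<lambda>h. dir_deriv (fst h *\<^sub>R kt + snd h *\<^sub>R kx) F p)) (at q)"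
      using has_derivative_compose[of ?G _ q UNIV F, OF dG] has_derivative_dir_deriv[OF F] f(3) by simp
    then show ?thesis
      using linear_add[OF dir_deriv_linear[OF F]] linear_cmul[OF dir_deriv_linear[OF F]] by simp
  qed
  have "image_is_graph_at (\<lambda>q. (T q, X q, V q)) f q"
  proof -
    have "((\<lambda>r. base_point (T (?G r), X (?G r), V (?G r))) has_derivative
        (\<lambda>h. (fst h * at' + snd h * ax, fst h * bt + snd h * bx))) (at q)"
      using dFG[OF B(3)] dFG[OF B(4)] by (auto simp: base_point_def at ax bt bx intro!: derivative_eq_intros)
    then have "frechet_derivative (\<lambda>r. base_point (T (?G r), X (?G r), V (?G r))) (at q)
        = (\<lambda>h. (fst h * at' + snd h * ax, fst h * bt + snd h * bx))"
      using frechet_derivative_at by force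
    moreover have "bij (\<lambda>h. (fst h * at' + snd h * ax, fst h * bt + snd h * bx))"
    proof -
      \<comment> \<open>The inverse of the 2 by 2 matrix with determinant \<open>\<Delta>\<close> is
        given by Cramer's rule.\<close>
      define i where "i = inverse \<Delta>"
      have i: "i * (at' * bx - ax * bt) = 1" using \<Delta> by (simp add: i_def)
      have "i * (bx * (a * at' + b * ax) - ax * (a * bt + b * bx)) = a"
        "i * (at' * (a * bt + b * bx) - bt * (a * at' + b * ax)) = b"
        "i * (bx * a - ax * b) * at' + i * (at' * b - bt * a) * ax = a"
        "i * (bx * a - ax * b) * bt + i * (at' * b - bt * a) * bx = b" for a b
        using i by algebra+
      then show ?thesis
        by (intro o_bij[where g = "\<lambda>y. (i * (bx * fst y - ax * snd y), i * (at' * snd y - bt * fst y))"])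
           (auto simp: fun_eq_iff)
    qed
    ultimately show ?thesis
      unfolding image_is_graph_at_def by simp
  qed
  then obtain D' E g where g: "open D'" "q \<in> D'" "D' \<subseteq> D" "?G ` D' \<subseteq> U" "burgers_solution E g"
    "(\<lambda>q. (T q, X q, V q)) ` ?G ` D' = graph_point g ` E"
    using sym f B unfolding burgers_point_symmetry_def maps_graph_to_solution_graph_at_def by blast
  have E: "open E" "smooth_on E g"
    using g(5) by (auto simp: burgers_solution_iff)
  have gV: "(T (?G r), X (?G r)) \<in> E" "g (T (?G r), X (?G r)) = V (?G r)" if "r \<in> D'" for r
  proof -
    have "(T (?G r), X (?G r), V (?G r)) \<in> graph_point g ` E"
      using that unfolding g(6)[symmetric] by blast
    then show "(T (?G r), X (?G r)) \<in> E" "g (T (?G r), X (?G r)) = V (?G r)"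
      by (auto simp: graph_point_def)
  qed
  define y where "y = (T p, X p)"
  have y: "y \<in> E" "g y = V p" using gV[OF g(2)] by (auto simp: y_def f(3))
  have gy: "g differentiable (at y)" using smooth_on_differentiable[OF E(2) y(1)] .
  define gt where "gt = dir_deriv (1, 0) g y"
  define gx where "gx = dir_deriv (0, 1) g y"
  have lin_g: "dir_deriv (a, b) g y = a * gt + b * gx" for a b
    using dir_deriv_pair[OF gy, of a b] by (simp add: gt_def gx_def)

  have "((\<lambda>r. g (T (?G r), X (?G r))) has_derivative
      (\<lambda>h. dir_deriv (fst h * at' + snd h * ax, fst h * bt + snd h * bx) g y)) (at q)"
    using has_derivative_compose[OF has_derivative_Pair[OF dFG[OF B(3)] dFG[OF B(4)]], of g]
      has_derivative_dir_deriv[OF gy] by (simp add: y_def f(3) at ax bt bx)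
  moreover have "((\<lambda>r. g (T (?G r), X (?G r))) has_derivative (\<lambda>h. fst h * wt + snd h * wx)) (at q)"
    by (rule has_derivative_transform_within_open[OF dFG[OF B(5), folded wt wx] g(1,2)]) (simp add: gV)
  ultimately have "(\<lambda>h. dir_deriv (fst h * at' + snd h * ax, fst h * bt + snd h * bx) g y)
      = (\<lambda>h. fst h * wt + snd h * wx)"
    using has_derivative_unique by blast
  from fun_cong[OF this, of "(1, 0)"] fun_cong[OF this, of "(0, 1)"]
  have first: "at' * gt + bt * gx = wt" "ax * gt + bx * gx = wx"
    by (simp_all add: lin_g)

  define \<xi> where "\<xi> = (- ax, at')"
  define c where "c s = ?G (q + s *\<^sub>R \<xi>)" for s
  define c' where "c' s = (- ax, at', dir_deriv \<xi> f (q + s *\<^sub>R \<xi>))" for s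
  \<comment> \<open>The parameters for which the line stays in both domains and its lift to the
    graph stays in \<open>B\<close>, where the components are smooth.\<close>
  define I where "I = {s. q + s *\<^sub>R \<xi> \<in> D' \<inter> D \<inter> ?G -` B}"
  have "continuous_on D ?G"
    unfolding graph_point_def by (intro continuous_intros smooth_on_continuous_on[OF D(2)])
  then have "open (D' \<inter> (D \<inter> ?G -` B))"
    using D(1) B(1) g(1) continuous_on_open_vimage by (metis Int_commute open_Int)
  moreover have continuous_on_line: "continuous_on UNIV (\<lambda>s. q + s *\<^sub>R \<xi>)"
    by (intro continuous_intros)
  ultimately have "open I"
    using open_vimage[of "D' \<inter> (D \<inter> ?G -` B)" "\<lambda>s. q + s *\<^sub>R \<xi>"] continuous_on_line
    by (auto simp: I_def vimage_def)
  have "0 \<in> I" using f g(2) by (auto simp: I_def)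
  have cI: "c s \<in> B" "q + s *\<^sub>R \<xi> \<in> D" "q + s *\<^sub>R \<xi> \<in> D'" if "s \<in> I" for s
    using that by (auto simp: I_def c_def)
  have c: "(c has_vector_derivative c' s) (at s)" if "s \<in> I" for s
  proof -
    have "((\<lambda>s. f (q + s *\<^sub>R \<xi>)) has_real_derivative dir_deriv \<xi> f (q + s *\<^sub>R \<xi>)) (at s)"
      using has_real_derivative_along_line[OF smooth_on_differentiable[OF D(2) cI(2)[OF that]]] .
    moreover have "((\<lambda>s. fst (q + s *\<^sub>R \<xi>)) has_real_derivative - ax) (at s)"
      "((\<lambda>s. snd (q + s *\<^sub>R \<xi>)) has_real_derivative at') (at s)"
      by (auto simp: \<xi>_def intro!: derivative_eq_intros)
    ultimately show ?thesis
      unfolding c_def[abs_def] c'_def graph_point_def has_real_derivative_iff_has_vector_derivative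
      by (intro has_vector_derivative_Pair)
  qed
  have c'': "(c' has_vector_derivative (0, 0, r)) (at 0)"
  proof -
    have "((\<lambda>s. dir_deriv \<xi> f (q + s *\<^sub>R \<xi>)) has_real_derivative r) (at 0)"
      using has_real_derivative_along_line[OF smooth_on_differentiable[OF smooth_on_dir_deriv[OF D(2)] cI(2)[OF \<open>0 \<in> I\<close>]], of \<xi>]
      by (simp add: r[folded \<xi>_def])
    then show ?thesis
      unfolding c'_def[abs_def] has_real_derivative_iff_has_vector_derivative
      by (intro has_vector_derivative_Pair has_vector_derivative_const)
  qed
  have c0: "c 0 = p" "c' 0 = k"
  proof -
    have "dir_deriv \<xi> f q = - ax * dir_deriv (1, 0) f q + at' * dir_deriv (0, 1) f q"
      using dir_deriv_pair[OF smooth_on_differentiable[OF D(2) f(2)], of "- ax" at'] by (simp add: \<xi>_def)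
    then show "c 0 = p" "c' 0 = k"
      by (simp_all add: c_def c'_def f(3) k kt_def kx_def)
  qed
  have dF: "((\<lambda>s. F (c s)) has_real_derivative dir_deriv (c' s) F (c s)) (at s)"
    if "smooth_on B F" "s \<in> I" for F :: "real \<times> real \<times> real \<Rightarrow> real" and s
    by (rule dir_deriv_along_curve[of F c s, OF smooth_on_differentiable[OF that(1) cI(1)[OF that(2)]] c[OF that(2)]])
  \<comment> \<open>The second derivative of \<open>F\<close> along \<open>c\<close> at 0. The curve
    \<open>c\<close> lies over a straight line, so its acceleration \<open>(0, 0, r)\<close> is
    purely vertical.\<close>
  define F2 where "F2 F = dir_deriv k (dir_deriv k F) p + r * dir_deriv (0, 0, 1) F p"
    for F :: "real \<times> real \<times> real \<Rightarrow> real"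
  have ddF: "((\<lambda>s. dir_deriv (c' s) F (c s)) has_real_derivative F2 F) (at 0)"
    if "smooth_on B F" for F :: "real \<times> real \<times> real \<Rightarrow> real"
    using second_deriv_along_curve[of B F c 0 c', OF B(1) that cI(1)[OF \<open>0 \<in> I\<close>] c[OF \<open>0 \<in> I\<close>] c'']
      dir_deriv_triple[OF smooth_on_differentiable[OF that f(4)], of 0 0 r]
    by (simp add: c0 F2_def)
  have k0: "dir_deriv k F p = at' * dir_deriv kx F p - ax * dir_deriv kt F p"
    if "smooth_on B F" for F :: "real \<times> real \<times> real \<Rightarrow> real"
    using linear_diff[OF dir_deriv_linear[OF smooth_on_differentiable[OF that f(4)]]]
      linear_cmul[OF dir_deriv_linear[OF smooth_on_differentiable[OF that f(4)]]]
    by (simp add: k)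

  define e where "e s = (T (c s), X (c s))" for s
  define e' where "e' s = (dir_deriv (c' s) T (c s), dir_deriv (c' s) X (c s))" for s
  have e: "(e has_vector_derivative e' s) (at s)" if "s \<in> I" for s
    using dF[OF B(3) that] dF[OF B(4) that]
    unfolding e_def[abs_def] e'_def has_real_derivative_iff_has_vector_derivative
    by (intro has_vector_derivative_Pair)
  have e'': "(e' has_vector_derivative (F2 T, F2 X)) (at 0)"
    using ddF[OF B(3)] ddF[OF B(4)]
    unfolding e'_def[abs_def] has_real_derivative_iff_has_vector_derivative
    by (intro has_vector_derivative_Pair)
  have e0: "e 0 = y" "e' 0 = \<Delta> *\<^sub>R (0, 1)"
    using k0[OF B(3)] k0[OF B(4)]
    by (simp_all add: e_def e'_def c0 y_def \<Delta>(1) at ax bt bx)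
  have eE: "e s \<in> E" "g (e s) = V (c s)" if "s \<in> I" for s
    using gV[OF cI(3)[OF that]] by (auto simp: e_def c_def)
  have eq: "dir_deriv (e' s) g (e s) = dir_deriv (c' s) V (c s)" if "s \<in> I" for s
  proof (rule DERIV_unique)
    show "((\<lambda>s. g (e s)) has_real_derivative dir_deriv (e' s) g (e s)) (at s)"
      by (rule dir_deriv_along_curve[of g e s, OF smooth_on_differentiable[OF E(2) eE(1)[OF that]] e[OF that]])
    show "((\<lambda>s. g (e s)) has_real_derivative dir_deriv (c' s) V (c s)) (at s)"
      by (rule has_field_derivative_transform_within_open[OF dF[OF B(5) that] \<open>open I\<close> that]) (simp add: eE)
  qed
  have gxx: "dir_deriv (0, 1) (dir_deriv (0, 1) g) y = gt + V p * gx"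
    using g(5) y unfolding burgers_solution_iff gt_def gx_def by metis
  have "F2 V = dir_deriv (e' 0) (dir_deriv (e' 0) g) (e 0) + dir_deriv (F2 T, F2 X) g (e 0)"
  proof (rule DERIV_unique)
    show "((\<lambda>s. dir_deriv (e' s) g (e s)) has_real_derivative
        dir_deriv (e' 0) (dir_deriv (e' 0) g) (e 0) + dir_deriv (F2 T, F2 X) g (e 0)) (at 0)"
      by (rule second_deriv_along_curve[of E g e 0 e', OF E eE(1)[OF \<open>0 \<in> I\<close>] e[OF \<open>0 \<in> I\<close>] e''])
    show "((\<lambda>s. dir_deriv (e' s) g (e s)) has_real_derivative F2 V) (at 0)"
      by (rule has_field_derivative_transform_within_open[OF ddF[OF B(5)] \<open>open I\<close> \<open>0 \<in> I\<close>]) (simp add: eq)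
  qed
  also have "\<dots> = \<Delta>\<^sup>2 * (gt + V p * gx) + F2 T * gt + F2 X * gx"
    unfolding e0 second_dir_deriv_scaleR[OF E y(1)] gxx lin_g by simp
  finally have "F2 V = \<Delta>\<^sup>2 * (gt + V p * gx) + F2 T * gt + F2 X * gx" .
  \<comment> \<open>Cramer's rule for the equations \<open>first\<close>; it explains the factor
    \<open>\<Delta>\<close> on the left of the claim, which keeps the identity free of
    quotients.\<close>
  moreover have "bx * wt - bt * wx = \<Delta> * gt" "at' * wx - ax * wt = \<Delta> * gx"
    by (simp_all add: first[symmetric] \<Delta>(1) algebra_simps)
  ultimately show ?thesis
    unfolding F2_def[symmetric] by (simp add: algebra_simps)
qed

subsection \<open>Splitting with respect to the jet of the solution\<close>

abbreviation dt :: "(real \<times> real \<times> real \<Rightarrow> real) \<Rightarrow> real \<times> real \<times> real \<Rightarrow> real" where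
  "dt \<equiv> dir_deriv (1, 0, 0)"

abbreviation dx :: "(real \<times> real \<times> real \<Rightarrow> real) \<Rightarrow> real \<times> real \<times> real \<Rightarrow> real" where
  "dx \<equiv> dir_deriv (0, 1, 0)"

abbreviation dv :: "(real \<times> real \<times> real \<Rightarrow> real) \<Rightarrow> real \<times> real \<times> real \<Rightarrow> real" where
  "dv \<equiv> dir_deriv (0, 0, 1)"

section \<open>The Jacobian determinant and the equation for free jet values\<close>

definition jacobian ::
    "(real \<times> real \<times> real \<Rightarrow> real) \<Rightarrow> (real \<times> real \<times> real \<Rightarrow> real) \<Rightarrow> (real \<times> real \<times> real \<Rightarrow> real) \<Rightarrow>
     real \<times> real \<times> real \<Rightarrow> real" where
  "jacobian T X V p = dt T p * (dx X p * dv V p - dv X p * dx V p)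
     - dx T p * (dt X p * dv V p - dv X p * dt V p)
     + dv T p * (dt X p * dx V p - dx X p * dt V p)"

text \<open>Multiplicativity of 3 by 3 determinants: the factors have rows \<open>a, b, c\<close>
  and \<open>x, y, z\<close>, and the right-hand side is the determinant of the matrix of their dot
  products.\<close>

lemma det3_mult:
  fixes a1 :: real
  shows "(a1 * (b2 * c3 - b3 * c2) - a2 * (b1 * c3 - b3 * c1) + a3 * (b1 * c2 - b2 * c1))
    * (x1 * (y2 * z3 - y3 * z2) - x2 * (y1 * z3 - y3 * z1) + x3 * (y1 * z2 - y2 * z1))
    = (x1 * a1 + x2 * a2 + x3 * a3) * ((y1 * b1 + y2 * b2 + y3 * b3) * (z1 * c1 + z2 * c2 + z3 * c3)
        - (y1 * c1 + y2 * c2 + y3 * c3) * (z1 * b1 + z2 * b2 + z3 * b3))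
    - (x1 * b1 + x2 * b2 + x3 * b3) * ((y1 * a1 + y2 * a2 + y3 * a3) * (z1 * c1 + z2 * c2 + z3 * c3)
        - (y1 * c1 + y2 * c2 + y3 * c3) * (z1 * a1 + z2 * a2 + z3 * a3))
    + (x1 * c1 + x2 * c2 + x3 * c3) * ((y1 * a1 + y2 * a2 + y3 * a3) * (z1 * b1 + z2 * b2 + z3 * b3)
        - (y1 * b1 + y2 * b2 + y3 * b3) * (z1 * a1 + z2 * a2 + z3 * a3))"
  by algebra

text \<open>Preimages of the three unit vectors form a matrix whose product with the Jacobian matrix
  is the identity, so the product of the two determinants is 1.\<close>

lemma jacobian_nonzero:
  assumes diff: "T differentiable (at p)" "X differentiable (at p)" "V differentiable (at p)"
    and surj: "\<And>y. \<exists>n. dir_deriv n (\<lambda>q. (T q, X q, V q)) p = y"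
  shows "jacobian T X V p \<noteq> 0"
proof
  assume J: "jacobian T X V p = 0"
  have "dir_deriv n (\<lambda>q. (T q, X q, V q)) p = (dir_deriv n T p, dir_deriv n X p, dir_deriv n V p)" for n
    by (rule dir_deriv_eq) (intro has_derivative_Pair has_derivative_dir_deriv diff)
  then have ex: "\<exists>n1 n2 n3. n1 * dt T p + n2 * dx T p + n3 * dv T p = y1 \<and>
      n1 * dt X p + n2 * dx X p + n3 * dv X p = y2 \<and> n1 * dt V p + n2 * dx V p + n3 * dv V p = y3" for y1 y2 y3
    using surj[of "(y1, y2, y3)"] diff[THEN dir_deriv_triple] by (metis prod.inject prod_cases3 real_scaleR_def)
  obtain x1 x2 x3 where x: "x1 * dt T p + x2 * dx T p + x3 * dv T p = 1"
    "x1 * dt X p + x2 * dx X p + x3 * dv X p = 0" "x1 * dt V p + x2 * dx V p + x3 * dv V p = 0"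
    using ex[of 1 0 0] by blast
  obtain y1 y2 y3 where y: "y1 * dt T p + y2 * dx T p + y3 * dv T p = 0"
    "y1 * dt X p + y2 * dx X p + y3 * dv X p = 1" "y1 * dt V p + y2 * dx V p + y3 * dv V p = 0"
    using ex[of 0 1 0] by blast
  obtain z1 z2 z3 where z: "z1 * dt T p + z2 * dx T p + z3 * dv T p = 0"
    "z1 * dt X p + z2 * dx X p + z3 * dv X p = 0" "z1 * dt V p + z2 * dx V p + z3 * dv V p = 1"
    using ex[of 0 0 1] by blast
  show False
    using det3_mult[of "dt T p" "dx X p" "dv V p" "dv X p" "dx V p" "dx T p" "dt X p" "dt V p" "dv T p"
        x1 y2 z3 y3 z2 x2 y1 z1 x3] J
    by (simp add: jacobian_def x y z)
qed

text \<open>\<open>P\<close>, \<open>R\<close>, \<open>M\<close> stand for \<open>f_x\<close>,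
  \<open>f_xx\<close>, \<open>f_tt\<close>, and \<open>R - v * P\<close> for \<open>f_t\<close>, so
  the solution itself has disappeared. \<open>K\<close> is chosen before \<open>M\<close>, which
  allows the equations for two values of \<open>M\<close> to be subtracted.\<close>

lemma point_symmetry_jet_equation:
  fixes T X V :: "real \<times> real \<times> real \<Rightarrow> real"
  assumes sym: "burgers_point_symmetry U (\<lambda>q. (T q, X q, V q))"
    and B: "open B" "B \<subseteq> U" "smooth_on B T" "smooth_on B X" "smooth_on B V"
    and p: "p \<in> B" "v = snd (snd p)"
    and at: "at' = dt T p + (R - v * P) * dv T p" and ax: "ax = dx T p + P * dv T p"
    and bt: "bt = dt X p + (R - v * P) * dv X p" and bx: "bx = dx X p + P * dv X p"
    and wt: "wt = dt V p + (R - v * P) * dv V p" and wx: "wx = dx V p + P * dv V p"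
    and \<Delta>: "\<Delta> = at' * bx - ax * bt" "\<Delta> \<noteq> 0"
    and k: "k = (- ax, at', at' * P - ax * (R - v * P))"
  shows "\<exists>K. \<forall>M. \<Delta> * (dir_deriv k (dir_deriv k V) p + (M * ax\<^sup>2 - 2 * K * ax * at' + R * at'\<^sup>2) * dv V p)
    = \<Delta>\<^sup>2 * ((bx * wt - bt * wx) + V p * (at' * wx - ax * wt))
      + (bx * wt - bt * wx) * (dir_deriv k (dir_deriv k T) p + (M * ax\<^sup>2 - 2 * K * ax * at' + R * at'\<^sup>2) * dv T p)
      + (at' * wx - ax * wt) * (dir_deriv k (dir_deriv k X) p + (M * ax\<^sup>2 - 2 * K * ax * at' + R * at'\<^sup>2) * dv X p)"
proof -
  obtain t x where tx: "p = (t, x, v)" using p(2) by (metis prod.collapse)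
  obtain K where K: "\<And>M. \<exists>D f. burgers_solution D f \<and> (t, x) \<in> D \<and> f (t, x) = v \<and>
     dir_deriv (0, 1) f (t, x) = P \<and> dir_deriv (1, 0) f (t, x) = R - v * P \<and>
     (\<forall>\<xi>. dir_deriv \<xi> (dir_deriv \<xi> f) (t, x)
        = M * (fst \<xi>)\<^sup>2 + 2 * K * fst \<xi> * snd \<xi> + R * (snd \<xi>)\<^sup>2)"
    using burgers_solution_with_jet[of t x v P R] by blast
  have lin: "dir_deriv (1, 0, R - v * P) F p = dt F p + (R - v * P) * dv F p"
    "dir_deriv (0, 1, P) F p = dx F p + P * dv F p" if "smooth_on B F" for F :: "real \<times> real \<times> real \<Rightarrow> real"
    using dir_deriv_triple[OF smooth_on_differentiable[OF that p(1)], of 1 0 "R - v * P"]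
      dir_deriv_triple[OF smooth_on_differentiable[OF that p(1)], of 0 1 P] by simp_all
  show ?thesis
  proof (intro exI allI)
    fix M
    obtain D f where f: "burgers_solution D f" "(t, x) \<in> D" "f (t, x) = v"
     "dir_deriv (0, 1) f (t, x) = P" "dir_deriv (1, 0) f (t, x) = R - v * P"
     "\<And>\<xi>. dir_deriv \<xi> (dir_deriv \<xi> f) (t, x)
        = M * (fst \<xi>)\<^sup>2 + 2 * K * fst \<xi> * snd \<xi> + R * (snd \<xi>)\<^sup>2"
      using K[of M] by blast
    have "p = graph_point f (t, x)" by (simp add: graph_point_def tx f)
    moreover have "k = at' *\<^sub>R (0, 1, P) - ax *\<^sub>R (1, 0, R - v * P)" by (simp add: k)
    moreover have "M * ax\<^sup>2 - 2 * K * ax * at' + R * at'\<^sup>2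
        = dir_deriv (- ax, at') (dir_deriv (- ax, at') f) (t, x)" by (simp add: f(6))
    ultimately show "\<Delta> * (dir_deriv k (dir_deriv k V) p + (M * ax\<^sup>2 - 2 * K * ax * at' + R * at'\<^sup>2) * dv V p)
    = \<Delta>\<^sup>2 * ((bx * wt - bt * wx) + V p * (at' * wx - ax * wt))
      + (bx * wt - bt * wx) * (dir_deriv k (dir_deriv k T) p + (M * ax\<^sup>2 - 2 * K * ax * at' + R * at'\<^sup>2) * dv T p)
      + (at' * wx - ax * wt) * (dir_deriv k (dir_deriv k X) p + (M * ax\<^sup>2 - 2 * K * ax * at' + R * at'\<^sup>2) * dv X p)"
      using p(1) f(4,5) lin[OF B(3)] lin[OF B(4)] lin[OF B(5)] at ax bt bx wt wx
      by (intro point_symmetry_identity[OF sym B f(1,2) _ _ _ _ _ _ _ _ \<Delta>]) simp_all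
  qed
qed

text \<open>The coefficient of \<open>v\<^sub>t\<^sub>t\<close> in the jet equation is the Jacobian times \<open>(D\<^sub>x T)\<^sup>2\<close>.\<close>

lemma point_symmetry_time_component:
  fixes T X V :: "real \<times> real \<times> real \<Rightarrow> real"
  assumes sym: "burgers_point_symmetry U (\<lambda>q. (T q, X q, V q))"
    and B: "open B" "B \<subseteq> U" "smooth_on B T" "smooth_on B X" "smooth_on B V"
    and p: "p \<in> B" and J: "jacobian T X V p \<noteq> 0"
  shows "dx T p = 0" "dv T p = 0"
proof -
  define v where "v = snd (snd p)"
  \<comment> \<open>The coefficients of \<open>\<Delta>\<close> as a function of
    \<open>w = f_t\<close> and \<open>P = f_x\<close>; the terms with \<open>w * P\<close>
    cancel.\<close>
  define a0 where "a0 = dt T p * dx X p - dx T p * dt X p"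
  define a1 where "a1 = dv T p * dx X p - dx T p * dv X p"
  define a2 where "a2 = dt T p * dv X p - dv T p * dt X p"
  have *: "dx T p + P * dv T p = 0" if ne: "a0 + a1 * w + a2 * P \<noteq> 0" for P w
  proof -
    define R where "R = w + v * P"
    \<comment> \<open>\<open>R\<close> was set to \<open>w + v * P\<close> so that
      \<open>f_t = w\<close> and \<open>f_x = P\<close> vary independently.\<close>
    define at' where "at' = dt T p + w * dv T p"
    define ax where "ax = dx T p + P * dv T p"
    define bt where "bt = dt X p + w * dv X p"
    define bx where "bx = dx X p + P * dv X p"
    define wt where "wt = dt V p + w * dv V p"
    define wx where "wx = dx V p + P * dv V p"
    define \<Delta> where "\<Delta> = at' * bx - ax * bt"
    have w: "w = R - v * P" by (simp add: R_def)
    have "\<Delta> = a0 + a1 * w + a2 * P"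
      by (simp add: \<Delta>_def a0_def a1_def a2_def at'_def ax_def bt_def bx_def algebra_simps)
    with ne have "\<Delta> \<noteq> 0" by simp
    obtain c1 c2 c3 c4 K where id: "\<And>M. \<Delta> * (c1 + (M * ax\<^sup>2 - 2 * K * ax * at' + R * at'\<^sup>2) * dv V p)
      = c2 + (bx * wt - bt * wx) * (c3 + (M * ax\<^sup>2 - 2 * K * ax * at' + R * at'\<^sup>2) * dv T p)
        + (at' * wx - ax * wt) * (c4 + (M * ax\<^sup>2 - 2 * K * ax * at' + R * at'\<^sup>2) * dv X p)"
      using point_symmetry_jet_equation[OF sym B p v_def
          at'_def[unfolded w] ax_def bt_def[unfolded w] bx_def wt_def[unfolded w] wx_def \<Delta>_def \<open>\<Delta> \<noteq> 0\<close> refl]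
      by blast
    \<comment> \<open>The difference of the equations for \<open>M = 1\<close> and
      \<open>M = 0\<close>.\<close>
    have "ax\<^sup>2 * (\<Delta> * dv V p - (bx * wt - bt * wx) * dv T p - (at' * wx - ax * wt) * dv X p) = 0"
      using id[of 0] id[of 1] by algebra
    moreover have "\<Delta> * dv V p - (bx * wt - bt * wx) * dv T p - (at' * wx - ax * wt) * dv X p = jacobian T X V p"
      unfolding jacobian_def \<Delta>_def at'_def ax_def bt_def bx_def wt_def wx_def by algebra
    ultimately show ?thesis
      using J by (simp add: ax_def)
  qed
  have ne: "a0 \<noteq> 0 \<or> a1 \<noteq> 0 \<or> a2 \<noteq> 0"
  proof (rule ccontr)
    assume "\<not> ?thesis"
    then have "a0 = 0" "a1 = 0" "a2 = 0" by auto
    \<comment> \<open>Expansion of the determinant along the row of \<open>V\<close>.\<close>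
    moreover have "jacobian T X V p = a0 * dv V p - a1 * dt V p - a2 * dx V p"
      unfolding jacobian_def a0_def a1_def a2_def by algebra
    ultimately show False using J by simp
  qed
  \<comment> \<open>Two distinct admissible \<open>P\<close> suffice, because
    \<open>T_x + P * T_v\<close> is affine in \<open>P\<close>. The witnesses are found by solving
    for values such as 1 or 2 of \<open>\<Delta>\<close>, through \<open>P\<close> if
    \<open>a1 = 0\<close> and through \<open>w\<close> otherwise.\<close>
  have "\<exists>P Q. P \<noteq> Q \<and> dx T p + P * dv T p = 0 \<and> dx T p + Q * dv T p = 0"
  proof (cases "a1 = 0")
    case True
    have "\<exists>P Q. P \<noteq> Q \<and> a0 + a2 * P \<noteq> 0 \<and> a0 + a2 * Q \<noteq> 0"
    proof (cases "a2 = 0")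
      case True
      then show ?thesis using ne \<open>a1 = 0\<close> by (intro exI[of _ 0] exI[of _ 1]) simp
    next
      case False
      then show ?thesis by (intro exI[of _ "(1 - a0) / a2"] exI[of _ "(2 - a0) / a2"]) simp
    qed
    then show ?thesis using *[of 0] by auto
  next
    case False
    then have "a0 + a1 * ((1 - a0) / a1) + a2 * 0 \<noteq> 0" "a0 + a1 * ((1 - a0 - a2) / a1) + a2 * 1 \<noteq> 0"
      by simp_all
    from *[OF this(1)] *[OF this(2)] show ?thesis
      by (intro exI[of _ 0] exI[of _ 1]) simp
  qed
  then obtain P Q where PQ: "P \<noteq> Q" "dx T p + P * dv T p = 0" "dx T p + Q * dv T p = 0" by blast
  have "(P - Q) * dv T p = (dx T p + P * dv T p) - (dx T p + Q * dv T p)" by algebra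
  then have "(P - Q) * dv T p = 0" using PQ by simp
  then show "dv T p = 0" using PQ(1) by simp
  then show "dx T p = 0" using PQ(2) by simp
qed

section \<open>Splitting when \<open>T\<close> depends on \<open>t\<close> alone\<close>

lemma second_dir_deriv_combination:
  fixes F :: "real \<times> real \<times> real \<Rightarrow> real"
  assumes "open B" "smooth_on B F" "p \<in> B"
  shows "dir_deriv (0, 1, P) (dir_deriv (0, 1, P) F) p
    = dx (dx F) p + 2 * P * dv (dx F) p + P\<^sup>2 * dv (dv F) p"
proof -
  note d = smooth_on_differentiable[OF smooth_on_dir_deriv[OF assms(2)] assms(3)]
  have "dir_deriv (0, 1, P) (dir_deriv (0, 1, P) F) p
      = dir_deriv (0, 1, P) (\<lambda>q. dx F q + P * dv F q) p"
  proof (rule dir_deriv_cong[OF assms(1,3)])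
    show "dir_deriv (0, 1, P) F q = dx F q + P * dv F q" if "q \<in> B" for q
      using dir_deriv_triple[OF smooth_on_differentiable[OF assms(2) that], of 0 1 P] by simp
  qed
  also have "\<dots> = dir_deriv (0, 1, P) (dx F) p + P * dir_deriv (0, 1, P) (dv F) p"
    by (intro dir_deriv_eq has_derivative_add has_derivative_mult_right has_derivative_dir_deriv d)
  also have "dir_deriv (0, 1, P) (dx F) p = dx (dx F) p + P * dv (dx F) p"
    using dir_deriv_triple[OF d, of 0 1 P] by simp
  also have "dir_deriv (0, 1, P) (dv F) p = dv (dx F) p + P * dv (dv F) p"
    using dir_deriv_triple[OF d, of 0 1 P "(0, 0, 1)"] dir_deriv_commute[OF assms, of "(0, 1, 0)" "(0, 0, 1)"] by simp
  finally show ?thesis by (simp add: power2_eq_square algebra_simps)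
qed

text \<open>Now \<open>D_x T = 0\<close> and \<open>D_t T = T_t\<close>, so the terms with
  \<open>M\<close> and \<open>K\<close> vanish, \<open>\<Delta> = T_t * bx\<close>, and the
  direction of second differentiation is \<open>T_t\<close> times \<open>(0, 1, P)\<close>. A common
  factor \<open>T_t\<close> squared cancels.\<close>

lemma point_symmetry_reduced_equation:
  fixes T X V :: "real \<times> real \<times> real \<Rightarrow> real"
  assumes sym: "burgers_point_symmetry U (\<lambda>q. (T q, X q, V q))"
    and B: "open B" "B \<subseteq> U" "smooth_on B T" "smooth_on B X" "smooth_on B V"
    and T: "\<forall>q\<in>B. dx T q = 0" "\<forall>q\<in>B. dv T q = 0"
    and p: "p \<in> B" "v = snd (snd p)" "dt T p \<noteq> 0"
    and bx: "bx = dx X p + P * dv X p" "bx \<noteq> 0"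
  shows "bx * dt T p * (dir_deriv (0, 1, P) (dir_deriv (0, 1, P) V) p + R * dv V p)
    = bx\<^sup>2 * (bx * (dt V p + (R - v * P) * dv V p) - (dt X p + (R - v * P) * dv X p) * (dx V p + P * dv V p)
        + V p * dt T p * (dx V p + P * dv V p))
      + dt T p * (dx V p + P * dv V p) * (dir_deriv (0, 1, P) (dir_deriv (0, 1, P) X) p + R * dv X p)"
proof -
  define \<tau> where "\<tau> = dt T p"
  define k :: "real \<times> real \<times> real" where "k = (0, 1, P)"
  have \<tau>: "\<tau> \<noteq> 0" "\<tau> * bx \<noteq> 0" using p bx by (simp_all add: \<tau>_def)
  have t0: "\<tau> = dt T p + (R - v * P) * dv T p" "0 = dx T p + P * dv T p"
    "(0 :: real, \<tau>, \<tau> * P) = (- 0, \<tau>, \<tau> * P - 0 * (R - v * P))"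
    by (simp_all add: T[THEN bspec, OF p(1)] \<tau>_def)
  have scale: "dir_deriv (0, \<tau>, \<tau> * P) (dir_deriv (0, \<tau>, \<tau> * P) F) p = \<tau>\<^sup>2 * dir_deriv k (dir_deriv k F) p"
    if "smooth_on B F" for F :: "real \<times> real \<times> real \<Rightarrow> real"
    using second_dir_deriv_scaleR[OF B(1) that p(1), of \<tau> k] by (simp add: k_def)
  have "dir_deriv k (dir_deriv k T) p = dir_deriv k (\<lambda>_. 0) p"
  proof (rule dir_deriv_cong[OF B(1) p(1)])
    show "dir_deriv k T q = 0" if "q \<in> B" for q
      using dir_deriv_triple[OF smooth_on_differentiable[OF B(3) that], of 0 1 P] T that by (simp add: k_def)
  qed
  then have Tkk: "dir_deriv k (dir_deriv k T) p = 0"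
    by (simp add: dir_deriv_def)
  obtain K where
    "\<tau> * bx * (\<tau>\<^sup>2 * dir_deriv k (dir_deriv k V) p + R * \<tau>\<^sup>2 * dv V p)
    = (\<tau> * bx)\<^sup>2 * ((bx * (dt V p + (R - v * P) * dv V p)
          - (dt X p + (R - v * P) * dv X p) * (dx V p + P * dv V p)) + V p * (\<tau> * (dx V p + P * dv V p)))
      + (\<tau> * (dx V p + P * dv V p)) * (\<tau>\<^sup>2 * dir_deriv k (dir_deriv k X) p + R * \<tau>\<^sup>2 * dv X p)"
    using point_symmetry_jet_equation[OF sym B p(1,2) t0(1,2) refl bx(1) refl refl _ _ t0(3), of "\<tau> * bx"] \<tau>
    by (simp add: scale B T[THEN bspec, OF p(1)] Tkk)
  then have "\<tau>\<^sup>2 * (bx * \<tau> * (dir_deriv k (dir_deriv k V) p + R * dv V p))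
    = \<tau>\<^sup>2 * (bx\<^sup>2 * (bx * (dt V p + (R - v * P) * dv V p) - (dt X p + (R - v * P) * dv X p) * (dx V p + P * dv V p)
        + V p * \<tau> * (dx V p + P * dv V p))
      + \<tau> * (dx V p + P * dv V p) * (dir_deriv k (dir_deriv k X) p + R * dv X p))"
    by algebra
  then show ?thesis
    using \<tau>(1) unfolding \<tau>_def k_def by simp
qed

text \<open>
  The coefficient of \<open>v\<^sub>x\<^sub>x\<close> forces \<open>(X\<^sub>x + X\<^sub>v P)\<^sup>2 = T\<^sub>t\<close> for all values \<open>P\<close> of \<open>v\<^sub>x\<close> with a nonzero
  left-hand side.
\<close>

lemma point_symmetry_space_component:
  fixes T X V :: "real \<times> real \<times> real \<Rightarrow> real"
  assumes sym: "burgers_point_symmetry U (\<lambda>q. (T q, X q, V q))"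
    and B: "open B" "B \<subseteq> U" "smooth_on B T" "smooth_on B X" "smooth_on B V"
    and T: "\<And>q. q \<in> B \<Longrightarrow> dx T q = 0" "\<And>q. q \<in> B \<Longrightarrow> dv T q = 0"
    and p: "p \<in> B" and J: "jacobian T X V p \<noteq> 0"
  shows "dv X p = 0" "(dx X p)\<^sup>2 = dt T p" "dx X p \<noteq> 0" "dv V p \<noteq> 0"
proof -
  have J': "dt T p * (dx X p * dv V p - dv X p * dx V p) \<noteq> 0"
    using J T[OF p] by (simp add: jacobian_def)
  have sq: "(dx X p + P * dv X p)\<^sup>2 = dt T p" if "dx X p + P * dv X p \<noteq> 0" for P
  proof -
    define bx where "bx = dx X p + P * dv X p"
    have T': "\<forall>q\<in>B. dx T q = 0" "\<forall>q\<in>B. dv T q = 0" using T by auto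
    have "dt T p \<noteq> 0" using J' by auto
    note eq = point_symmetry_reduced_equation[OF sym B T' p refl this bx_def that[folded bx_def]]
    \<comment> \<open>The difference of the equations for \<open>R = 1\<close> and
      \<open>R = 0\<close>. Its second factor is the minor of the Jacobian that \<open>J'\<close>
      shows to be nonzero; it does not depend on \<open>P\<close>.\<close>
    have "(dt T p - bx\<^sup>2) * (dx X p * dv V p - dv X p * dx V p) = 0"
      using eq[of 0] eq[of 1] unfolding bx_def by algebra
    then show ?thesis using J' by (simp add: bx_def)
  qed
  show X: "dv X p = 0"
  proof (rule ccontr)
    assume ne: "dv X p \<noteq> 0"
    \<comment> \<open>These \<open>P\<close> make \<open>X_x + P * X_v\<close> equal to 1 and 2, so
      \<open>T_t\<close> would be both 1 and 4.\<close>
    then show False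
      using sq[of "(1 - dx X p) / dv X p"] sq[of "(2 - dx X p) / dv X p"] by simp
  qed
  show "dx X p \<noteq> 0" "dv V p \<noteq> 0" using J' X by auto
  then show "(dx X p)\<^sup>2 = dt T p" using sq[of 0] by simp
qed

text \<open>\<open>X_xx = 0\<close> because the square of \<open>X_x\<close> is \<open>T_t\<close>,
  which is independent of \<open>x\<close>. The reduced equation with \<open>R = 0\<close> is then
  polynomial in \<open>P\<close> and holds for all \<open>P\<close>: its coefficients of degree 2, 0
  and 1 are the other three equations.\<close>

lemma point_symmetry_velocity_component:
  fixes T X V :: "real \<times> real \<times> real \<Rightarrow> real"
  assumes sym: "burgers_point_symmetry U (\<lambda>q. (T q, X q, V q))"
    and B: "open B" "B \<subseteq> U" "smooth_on B T" "smooth_on B X" "smooth_on B V"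
    and T: "\<And>q. q \<in> B \<Longrightarrow> dx T q = 0" "\<And>q. q \<in> B \<Longrightarrow> dv T q = 0"
    and X: "\<And>q. q \<in> B \<Longrightarrow> dv X q = 0" "\<And>q. q \<in> B \<Longrightarrow> (dx X q)\<^sup>2 = dt T q" "\<And>q. q \<in> B \<Longrightarrow> dx X q \<noteq> 0"
    and p: "p \<in> B"
  shows "dx (dx X) p = 0" "dv (dv V) p = 0"
    "dx X p * dx (dx V) p = dx X p * dt V p + (V p * (dx X p)\<^sup>2 - dt X p) * dx V p"
    "2 * dx X p * dv (dx V) p = - dx X p * snd (snd p) * dv V p + (V p * (dx X p)\<^sup>2 - dt X p) * dv V p"
proof -
  have const0: "dir_deriv h (\<lambda>_. 0) p = 0" for h
    by (simp add: dir_deriv_def)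
  have "dx (\<lambda>q. dx X q * dx X q) p = dx (dt T) p"
    using X(2) by (intro dir_deriv_cong[OF B(1) p]) (simp add: power2_eq_square)
  moreover have "dx (dt T) p = dt (dx T) p"
    by (rule dir_deriv_commute[OF B(1,3) p])
  moreover have "dt (dx T) p = 0"
    using dir_deriv_cong[OF B(1) p, of "dx T" "\<lambda>_. 0"] T(1) by (simp add: const0)
  moreover have "dx (\<lambda>q. dx X q * dx X q) p = dx X p * dx (dx X) p + dx (dx X) p * dx X p"
    by (intro dir_deriv_eq has_derivative_mult smooth_on_has_derivative[OF smooth_on_dir_deriv[OF B(4)] p])
  ultimately show xx: "dx (dx X) p = 0"
    using X(3)[OF p] by simp
  have "dv (dx X) p = dx (dv X) p"
    by (rule dir_deriv_commute[OF B(1,4) p])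
  moreover have "dir_deriv h (dv X) p = 0" for h
    using dir_deriv_cong[OF B(1) p, of "dv X" "\<lambda>_. 0"] X(1) by (simp add: const0)
  ultimately have Xkk: "dir_deriv (0, 1, P) (dir_deriv (0, 1, P) X) p = 0" for P
    using second_dir_deriv_combination[OF B(1,4) p, of P] xx by simp
  have "dt T p \<noteq> 0" using X(2)[OF p] X(3)[OF p] by (metis zero_eq_power2)
  moreover have "\<forall>q\<in>B. dx T q = 0" "\<forall>q\<in>B. dv T q = 0" using T by auto
  moreover have "dx X p = dx X p + P * dv X p" for P using X(1)[OF p] by simp
  ultimately have eq: "dx X p * dt T p * (dir_deriv (0, 1, P) (dir_deriv (0, 1, P) V) p + 0 * dv V p)
    = (dx X p)\<^sup>2 * (dx X p * (dt V p + (0 - snd (snd p) * P) * dv V p)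
        - (dt X p + (0 - snd (snd p) * P) * dv X p) * (dx V p + P * dv V p) + V p * dt T p * (dx V p + P * dv V p))
      + dt T p * (dx V p + P * dv V p) * (dir_deriv (0, 1, P) (dir_deriv (0, 1, P) X) p + 0 * dv X p)" for P
    using point_symmetry_reduced_equation[OF sym B _ _ p refl _ _ X(3)[OF p]] by blast
  have id: "dx X p * (dx (dx V) p + 2 * P * dv (dx V) p + P\<^sup>2 * dv (dv V) p)
    = dx X p * dt V p - dx X p * snd (snd p) * P * dv V p
      + (V p * (dx X p)\<^sup>2 - dt X p) * (dx V p + P * dv V p)" for P
  proof -
    have "(dx X p)\<^sup>2 * (dx X p * (dx (dx V) p + 2 * P * dv (dx V) p + P\<^sup>2 * dv (dv V) p))
      = (dx X p)\<^sup>2 * (dx X p * dt V p - dx X p * snd (snd p) * P * dv V p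
      + (V p * (dx X p)\<^sup>2 - dt X p) * (dx V p + P * dv V p))"
      using eq[of P]
      unfolding X(1)[OF p] Xkk second_dir_deriv_combination[OF B(1,5) p, of P] X(2)[OF p, symmetric]
      by algebra
    then show ?thesis
      using X(3)[OF p] by simp
  qed
  show "dx X p * dx (dx V) p = dx X p * dt V p + (V p * (dx X p)\<^sup>2 - dt X p) * dx V p"
    using id[of 0] by simp
  \<comment> \<open>The combination \<open>L 1 + L (- 1) - 2 * L 0\<close> isolates the quadratic
    coefficient on one side of the identity and vanishes on the other, which is affine in
    \<open>P\<close>.\<close>
  define L where "L P = dx X p * (dx (dx V) p + 2 * P * dv (dx V) p + P\<^sup>2 * dv (dv V) p)" for P
  have L: "L P = dx X p * dt V p - dx X p * snd (snd p) * P * dv V p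
      + (V p * (dx X p)\<^sup>2 - dt X p) * (dx V p + P * dv V p)" for P
    using id[of P] by (simp add: L_def)
  have "2 * dx X p * dv (dv V) p = L 1 + L (- 1) - 2 * L 0"
    by (simp add: L_def algebra_simps)
  also have "\<dots> = 0"
    unfolding L by (simp add: algebra_simps)
  finally have "2 * dx X p * dv (dv V) p = 0" .
  then show "dv (dv V) p = 0" using X(3)[OF p] by simp
  then show "2 * dx X p * dv (dx V) p = - dx X p * snd (snd p) * dv V p + (V p * (dx X p)\<^sup>2 - dt X p) * dv V p"
    using L[of 0] L[of 1] by (simp add: L_def algebra_simps)
qed

subsection \<open>Integration of the determining equations\<close>

lemma dir_deriv_diff:
  "F differentiable (at p) \<Longrightarrow> G differentiable (at p) \<Longrightarrow>
   dir_deriv h (\<lambda>q. F q - G q) p = dir_deriv h F p - dir_deriv h G p"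
  by (intro dir_deriv_eq has_derivative_diff has_derivative_dir_deriv)

lemma dir_deriv_mult:
  fixes F G :: "'a::real_normed_vector \<Rightarrow> real"
  shows "F differentiable (at p) \<Longrightarrow> G differentiable (at p) \<Longrightarrow>
   dir_deriv h (\<lambda>q. F q * G q) p = F p * dir_deriv h G p + dir_deriv h F p * G p"
  by (intro dir_deriv_eq has_derivative_mult has_derivative_dir_deriv)

lemma dir_deriv_minus:
  "F differentiable (at p) \<Longrightarrow> dir_deriv h (\<lambda>q. - F q) p = - dir_deriv h F p"
  by (intro dir_deriv_eq has_derivative_minus has_derivative_dir_deriv)

lemma dir_deriv_const: "dir_deriv h (\<lambda>_. c) p = 0"
  by (simp add: dir_deriv_def)

lemma dir_deriv_snd_snd: "dir_deriv h (\<lambda>q. snd (snd q)) p = snd (snd h)"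
  by (rule dir_deriv_eq) (intro derivative_intros)

lemma dir_deriv_zero:
  "open B \<Longrightarrow> p \<in> B \<Longrightarrow> (\<And>q. q \<in> B \<Longrightarrow> F q = 0) \<Longrightarrow> dir_deriv h F p = 0"
  using dir_deriv_cong[of B p F "\<lambda>_. 0"] by (simp add: dir_deriv_const)

lemma smooth_on_snd_snd: "open B \<Longrightarrow> smooth_on B (\<lambda>q :: real \<times> real \<times> real. snd (snd q))"
  by (intro smooth_on_snd smooth_on_ident)

text \<open>The v-derivative of \<open>eq1\<close> yields \<open>V_v * X_x = 1\<close>, and the
  x-derivative of this product yields \<open>V_vx = 0\<close>. What is left of \<open>eq1\<close>
  expresses \<open>X_t\<close>; comparing its second x-derivative with \<open>X_xxt = 0\<close>
  yields \<open>V_xx = 0\<close>, which reduces \<open>eq0\<close> to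
  \<open>V_t = - v * V_x\<close>.\<close>

lemma determining_equations_consequences:
  fixes T X V :: "real \<times> real \<times> real \<Rightarrow> real"
  assumes B: "open B" "smooth_on B T" "smooth_on B X" "smooth_on B V"
    and T: "\<And>q. q \<in> B \<Longrightarrow> dx T q = 0" "\<And>q. q \<in> B \<Longrightarrow> dv T q = 0"
    and X: "\<And>q. q \<in> B \<Longrightarrow> dv X q = 0" "\<And>q. q \<in> B \<Longrightarrow> dx X q \<noteq> 0" "\<And>q. q \<in> B \<Longrightarrow> dx (dx X) q = 0"
    and V: "\<And>q. q \<in> B \<Longrightarrow> dv V q \<noteq> 0" "\<And>q. q \<in> B \<Longrightarrow> dv (dv V) q = 0"
    and eq0: "\<And>q. q \<in> B \<Longrightarrow> dx X q * dx (dx V) q = dx X q * dt V q + (V q * (dx X q)\<^sup>2 - dt X q) * dx V q"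
    and eq1: "\<And>q. q \<in> B \<Longrightarrow> 2 * dx X q * dv (dx V) q
      = - dx X q * snd (snd q) * dv V q + (V q * (dx X q)\<^sup>2 - dt X q) * dv V q"
    and p: "p \<in> B"
  shows "dv V p * dx X p = 1" "V p * (dx X p)\<^sup>2 - dt X p = dx X p * snd (snd p)"
    "dt V p = - snd (snd p) * dx V p"
    "dt (dx V) p = 0" "dx (dx V) p = 0" "dv (dx V) p = 0"
    "dt (dv V) p = - dx V p" "dx (dv V) p = 0"
proof -
  note sm = B(2-4) B(2-4)[THEN smooth_on_dir_deriv] B(2-4)[THEN smooth_on_dir_deriv, THEN smooth_on_dir_deriv]
    smooth_on_snd_snd[OF B(1)]
  note diff = sm[THEN smooth_on_differentiable]
  note simps = dir_deriv_minus dir_deriv_diff dir_deriv_mult dir_deriv_const dir_deriv_snd_snd diff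
  note comm = dir_deriv_commute[OF B(1)]
  note zero = dir_deriv_zero[OF B(1)]
  have Xxv: "dv (dx X) q = 0" if "q \<in> B" for q
    using comm[OF B(3) that, of "(0, 0, 1)" "(0, 1, 0)"] zero[OF that X(1)] by simp
  have Xtv: "dv (dt X) q = 0" if "q \<in> B" for q
    using comm[OF B(3) that, of "(0, 0, 1)" "(1, 0, 0)"] zero[OF that X(1)] by simp
  have Vxvv: "dv (dv (dx V)) q = 0" if "q \<in> B" for q
  proof -
    have "dv (dv (dx V)) q = dv (dx (dv V)) q"
      by (rule dir_deriv_cong[OF B(1) that]) (rule comm[OF B(4)])
    also have "\<dots> = dx (dv (dv V)) q"
      by (rule comm[OF smooth_on_dir_deriv[OF B(4)] that])
    finally show ?thesis using zero[OF that V(2)] by simp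
  qed
  have inv: "dv V q * dx X q = 1" if q: "q \<in> B" for q
  proof -
    have "dv (\<lambda>q. 2 * dx X q * dv (dx V) q) q
      = dv (\<lambda>q. (V q * (dx X q * dx X q) - dt X q - dx X q * snd (snd q)) * dv V q) q"
    proof (rule dir_deriv_cong[OF B(1) q])
      show "2 * dx X r * dv (dx V) r = (V r * (dx X r * dx X r) - dt X r - dx X r * snd (snd r)) * dv V r"
        if "r \<in> B" for r
        using eq1[OF that] by (simp add: power2_eq_square algebra_simps)
    qed
    moreover have "dv (\<lambda>q. 2 * dx X q * dv (dx V) q) q = 0"
      using q by (simp add: simps Xxv Vxvv)
    moreover have "dv (\<lambda>q. (V q * (dx X q * dx X q) - dt X q - dx X q * snd (snd q)) * dv V q) q
      = (dv V q * (dx X q * dx X q) - dx X q) * dv V q"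
      using q by (simp add: simps Xxv Xtv V(2))
    ultimately have "dx X q * ((dv V q * dx X q - 1) * dv V q) = 0"
      by (simp add: algebra_simps)
    then show ?thesis using X(2)[OF q] V(1)[OF q] by simp
  qed
  have Vvx: "dx (dv V) q = 0" if q: "q \<in> B" for q
  proof -
    have "dx (\<lambda>q. dv V q * dx X q) q = dx (\<lambda>_. 1) q"
      by (rule dir_deriv_cong[OF B(1) q inv])
    then have "dx (dv V) q * dx X q = 0"
      using q by (simp add: simps X(3))
    then show ?thesis using X(2)[OF q] by simp
  qed
  have Vxv: "dv (dx V) q = 0" if "q \<in> B" for q
    using comm[OF B(4) that, of "(0, 0, 1)" "(0, 1, 0)"] Vvx[OF that] by simp
  have Xt: "V q * (dx X q)\<^sup>2 - dt X q = dx X q * snd (snd q)" if q: "q \<in> B" for q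
  proof -
    have "(V q * (dx X q)\<^sup>2 - dt X q - dx X q * snd (snd q)) * dv V q = 0"
      using eq1[OF q] Vxv[OF q] by (simp add: algebra_simps)
    then show ?thesis using V(1)[OF q] by simp
  qed
  have Vxx': "dx (dx V) q = dt V q + snd (snd q) * dx V q" if q: "q \<in> B" for q
  proof -
    have "dx X q * dx (dx V) q = dx X q * (dt V q + snd (snd q) * dx V q)"
      using eq0[OF q] unfolding Xt[OF q] by (simp add: algebra_simps)
    then show ?thesis using X(2)[OF q] by simp
  qed
  have Xtx: "dx (dt X) q = dx V q * (dx X q)\<^sup>2" if q: "q \<in> B" for q
  proof -
    have "dx (\<lambda>q. V q * (dx X q * dx X q) - dt X q) q = dx (\<lambda>q. dx X q * snd (snd q)) q"
      by (rule dir_deriv_cong[OF B(1) q]) (simp add: Xt flip: power2_eq_square)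
    then show ?thesis
      using q by (simp add: simps X(3) power2_eq_square)
  qed
  have Vxx: "dx (dx V) q = 0" if q: "q \<in> B" for q
  proof -
    have "dx (dx (dt X)) q = dx (dt (dx X)) q"
      by (rule dir_deriv_cong[OF B(1) q]) (rule comm[OF B(3)])
    also have "\<dots> = dt (dx (dx X)) q"
      by (rule comm[OF smooth_on_dir_deriv[OF B(3)] q])
    finally have "dx (dx (dt X)) q = 0" using zero[OF q X(3)] by simp
    moreover have "dx (dx (dt X)) q = dx (\<lambda>q. dx V q * (dx X q * dx X q)) q"
      by (rule dir_deriv_cong[OF B(1) q]) (simp add: Xtx power2_eq_square)
    ultimately have "dx (dx V) q * (dx X q * dx X q) = 0"
      using q by (simp add: simps X(3))
    then show ?thesis using X(2)[OF q] by simp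
  qed
  have Vt: "dt V q = (- 1) * snd (snd q) * dx V q" if "q \<in> B" for q
    using Vxx[OF that] Vxx'[OF that] by simp
  have "dx (dt V) p = dx (\<lambda>q. (- 1) * snd (snd q) * dx V q) p"
    by (rule dir_deriv_cong[OF B(1) p Vt])
  also have "\<dots> = 0"
    using p by (simp add: simps Vxx)
  finally show "dt (dx V) p = 0"
    using comm[OF B(4) p, of "(1, 0, 0)" "(0, 1, 0)"] by simp
  have "dv (dt V) p = dv (\<lambda>q. (- 1) * snd (snd q) * dx V q) p"
    by (rule dir_deriv_cong[OF B(1) p Vt])
  also have "\<dots> = - dx V p"
    using p by (simp add: simps Vxv)
  finally show "dt (dv V) p = - dx V p"
    using comm[OF B(4) p, of "(1, 0, 0)" "(0, 0, 1)"] by simp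
  show "dv V p * dx X p = 1" "V p * (dx X p)\<^sup>2 - dt X p = dx X p * snd (snd p)"
    "dt V p = - snd (snd p) * dx V p" "dx (dx V) p = 0" "dv (dx V) p = 0" "dx (dv V) p = 0"
    using inv Xt Vt Vxx Vxv Vvx p by simp_all
qed

lemma smooth_on_has_derivative_triple:
  fixes F :: "real \<times> real \<times> real \<Rightarrow> real"
  assumes "smooth_on B F" "p \<in> B"
  shows "(F has_derivative (\<lambda>h. fst h * dt F p + fst (snd h) * dx F p + snd (snd h) * dv F p)) (at p)"
proof -
  have "(\<lambda>h. dir_deriv h F p) = (\<lambda>h. fst h * dt F p + fst (snd h) * dx F p + snd (snd h) * dv F p)"
  proof
    show "dir_deriv h F p = fst h * dt F p + fst (snd h) * dx F p + snd (snd h) * dv F p" for h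
      using dir_deriv_triple[OF smooth_on_differentiable[OF assms], of "fst h" "fst (snd h)" "snd (snd h)"] by simp
  qed
  then show ?thesis
    using smooth_on_has_derivative[OF assms] by (simp only:)
qed

lemma equal_derivative_on_ball:
  fixes F G :: "'a::real_normed_vector \<Rightarrow> real"
  assumes "\<And>q. q \<in> ball p e \<Longrightarrow> (F has_derivative F' q) (at q)" "\<And>q. q \<in> ball p e \<Longrightarrow> (G has_derivative F' q) (at q)"
    and "F p = G p" "q \<in> ball p e"
  shows "F q = G q"
proof -
  have "p \<in> ball p e" using assms(4) by (metis centre_in_ball dist_not_less_zero dual_order.strict_trans1 linorder_not_less mem_ball)
  moreover have "((\<lambda>q. F q - G q) has_derivative (\<lambda>h. 0)) (at q within ball p e)" if "q \<in> ball p e" for q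
    using has_derivative_diff[OF assms(1)[OF that] assms(2)[OF that]] by (auto intro: has_derivative_at_withinI)
  ultimately have "F q - G q = F p - G p"
    using has_derivative_zero_unique[of "ball p e" "\<lambda>q. F q - G q" q p] assms(4) by simp
  then show ?thesis using assms(3) by simp
qed

text \<open>
  \<open>V\<close> is found first; then \<open>T\<close> and \<open>X\<close> have the first derivatives of a transformation whose remaining
  constants are fitted at the centre of the ball.
\<close>

lemma integrate_determining_equations:
  fixes T X V :: "real \<times> real \<times> real \<Rightarrow> real"
  assumes e: "0 < e" and B: "smooth_on (ball p e) T" "smooth_on (ball p e) X" "smooth_on (ball p e) V"
    and T: "\<And>q. q \<in> ball p e \<Longrightarrow> dx T q = 0" "\<And>q. q \<in> ball p e \<Longrightarrow> dv T q = 0"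
    and X: "\<And>q. q \<in> ball p e \<Longrightarrow> dv X q = 0" "\<And>q. q \<in> ball p e \<Longrightarrow> (dx X q)\<^sup>2 = dt T q"
    and V: "\<And>q. q \<in> ball p e \<Longrightarrow> dv V q * dx X q = 1" "\<And>q. q \<in> ball p e \<Longrightarrow> dv (dv V) q = 0"
      "\<And>q. q \<in> ball p e \<Longrightarrow> V q * (dx X q)\<^sup>2 - dt X q = dx X q * snd (snd q)"
      "\<And>q. q \<in> ball p e \<Longrightarrow> dt V q = - snd (snd q) * dx V q"
      "\<And>q. q \<in> ball p e \<Longrightarrow> dt (dx V) q = 0" "\<And>q. q \<in> ball p e \<Longrightarrow> dx (dx V) q = 0"
      "\<And>q. q \<in> ball p e \<Longrightarrow> dv (dx V) q = 0"
      "\<And>q. q \<in> ball p e \<Longrightarrow> dt (dv V) q = - dx V q" "\<And>q. q \<in> ball p e \<Longrightarrow> dx (dv V) q = 0"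
  shows "\<exists>\<alpha> \<beta> \<gamma> \<delta> l1 l0. \<alpha> * \<delta> - \<beta> * \<gamma> = 1 \<and> (\<forall>q\<in>ball p e. \<gamma> * fst q + \<delta> \<noteq> 0 \<and>
    (T q, X q, V q) = burgers_transformation \<alpha> \<beta> \<gamma> \<delta> l1 l0 q)"
proof -
  let ?B = "ball p e"
  have p: "p \<in> ?B" using e by simp
  note sd = smooth_on_has_derivative_triple[of ?B]
  define \<gamma> where "\<gamma> = - dx V p"
  have Vx: "dx V q = - \<gamma>" if "q \<in> ?B" for q
  proof (rule equal_derivative_on_ball[where F = "dx V" and F' = "\<lambda>_ _. 0"])
    show "(dx V has_derivative (\<lambda>_. 0)) (at q)" if "q \<in> ?B" for q
      using sd[OF smooth_on_dir_deriv[OF B(3)] that, of "(0, 1, 0)"] V that by simp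
  qed (use that in \<open>auto simp: \<gamma>_def\<close>)
  define \<delta> where "\<delta> = dv V p - \<gamma> * fst p"
  define m where "m q = \<gamma> * fst q + \<delta>" for q :: "real \<times> real \<times> real"
  have Vv: "dv V q = m q" if "q \<in> ?B" for q
  proof (rule equal_derivative_on_ball[where F = "dv V" and F' = "\<lambda>_ h. \<gamma> * fst h"])
    show "(dv V has_derivative (\<lambda>h. \<gamma> * fst h)) (at q)" if "q \<in> ?B" for q
      using sd[OF smooth_on_dir_deriv[OF B(3)] that, of "(0, 0, 1)"] V Vx that by (simp add: mult.commute)
    show "(m has_derivative (\<lambda>h. \<gamma> * fst h)) (at q)" for q
      unfolding m_def[abs_def] by (auto intro!: derivative_eq_intros)
  qed (use that in \<open>auto simp: m_def \<delta>_def\<close>)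
  have m: "m q \<noteq> 0" if "q \<in> ?B" for q
    using V(1)[OF that] Vv[OF that] by auto
  have Xx: "dx X q = 1 / m q" if "q \<in> ?B" for q
    using V(1)[OF that] Vv[OF that] m[OF that] by (simp add: field_simps)
  define \<kappa> where "\<kappa> = V p - m p * snd (snd p) + \<gamma> * fst (snd p)"
  have VV: "V q = m q * snd (snd q) - \<gamma> * fst (snd q) + \<kappa>" if "q \<in> ?B" for q
  proof (rule equal_derivative_on_ball[where F = V])
    show "(V has_derivative (\<lambda>h. \<gamma> * snd (snd q) * fst h - \<gamma> * fst (snd h) + m q * snd (snd h))) (at q)"
      if "q \<in> ?B" for q
      using sd[OF B(3) that] V(4)[OF that] Vx[OF that] Vv[OF that] by (simp add: algebra_simps)
    show "((\<lambda>q. m q * snd (snd q) - \<gamma> * fst (snd q) + \<kappa>) has_derivative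
      (\<lambda>h. \<gamma> * snd (snd q) * fst h - \<gamma> * fst (snd h) + m q * snd (snd h))) (at q)" for q
      unfolding m_def[abs_def] by (auto intro!: derivative_eq_intros simp: algebra_simps)
  qed (use that in \<open>auto simp: \<kappa>_def\<close>)
  \<comment> \<open>\<open>l1\<close> and \<open>l0\<close> solve
    \<open>l1 * \<delta> - l0 * \<gamma> = \<kappa>\<close> and \<open>l1 * fst p + l0 = s\<close>:
    the constant term of \<open>V\<close> and the value of \<open>X\<close> at \<open>p\<close>. The
    determinant of the system is \<open>m p\<close>.\<close>
  define s where "s = X p * m p - fst (snd p)"
  define l1 where "l1 = (\<kappa> + \<gamma> * s) / m p"
  define l0 where "l0 = s - l1 * fst p"
  have l: "l1 * \<delta> - l0 * \<gamma> = \<kappa>" "l1 * fst p + l0 = s"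
  proof -
    have "l1 * \<delta> - l0 * \<gamma> = l1 * m p - \<gamma> * s" by (simp add: l0_def m_def algebra_simps)
    then show "l1 * \<delta> - l0 * \<gamma> = \<kappa>" using m[OF p] by (simp add: l1_def)
  qed (simp add: l0_def)
  \<comment> \<open>The same linear system with right-hand sides 1 and \<open>r\<close> determines
    \<open>\<alpha>\<close> and \<open>\<beta>\<close>: the unit determinant condition and the value
    of \<open>T\<close> at \<open>p\<close>.\<close>
  define r where "r = T p * m p"
  define \<alpha> where "\<alpha> = (1 + \<gamma> * r) / m p"
  define \<beta> where "\<beta> = r - \<alpha> * fst p"
  have ab: "\<alpha> * \<delta> - \<beta> * \<gamma> = 1" "\<alpha> * fst p + \<beta> = r"
  proof -
    have "\<alpha> * \<delta> - \<beta> * \<gamma> = \<alpha> * m p - \<gamma> * r" by (simp add: \<beta>_def m_def algebra_simps)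
    then show "\<alpha> * \<delta> - \<beta> * \<gamma> = 1" using m[OF p] by (simp add: \<alpha>_def)
  qed (simp add: \<beta>_def)
  have dm: "(m has_derivative (\<lambda>h. \<gamma> * fst h)) (at q)" for q
    unfolding m_def[abs_def] by (auto intro!: derivative_eq_intros)
  have TT: "T q = (\<alpha> * fst q + \<beta>) / m q" if "q \<in> ?B" for q
  proof (rule equal_derivative_on_ball[where F = T])
    show "(T has_derivative (\<lambda>h. fst h / (m q * m q))) (at q)" if "q \<in> ?B" for q
      using sd[OF B(1) that] T[OF that] X(2)[OF that, symmetric] Xx[OF that] by (simp add: power2_eq_square)
    show "((\<lambda>q. (\<alpha> * fst q + \<beta>) / m q) has_derivative (\<lambda>h. fst h / (m q * m q))) (at q)" if "q \<in> ?B" for q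
    proof -
      have "\<alpha> * fst h * m q - (\<alpha> * fst q + \<beta>) * (\<gamma> * fst h) = (\<alpha> * \<delta> - \<beta> * \<gamma>) * fst h" for h :: "real \<times> real \<times> real"
        by (simp add: m_def algebra_simps)
      then have "\<alpha> * fst h * m q - (\<alpha> * fst q + \<beta>) * (\<gamma> * fst h) = fst h" for h :: "real \<times> real \<times> real"
        by (simp add: ab(1))
      moreover have "((\<lambda>q. (\<alpha> * fst q + \<beta>) / m q) has_derivative
          (\<lambda>h. (\<alpha> * fst h * m q - (\<alpha> * fst q + \<beta>) * (\<gamma> * fst h)) / (m q * m q))) (at q)"
        by (rule has_derivative_divide') (use m[OF that] in \<open>auto intro!: derivative_eq_intros dm\<close>)
      ultimately show ?thesis by simp
    qed
  qed (use that m[OF p] in \<open>auto simp: ab(2) r_def\<close>)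
  have XX: "X q = (fst (snd q) + l1 * fst q + l0) / m q" if "q \<in> ?B" for q
  proof (rule equal_derivative_on_ball[where F = X])
    show "(X has_derivative (\<lambda>h. ((\<kappa> - \<gamma> * fst (snd q)) * fst h + m q * fst (snd h)) / (m q * m q))) (at q)"
      if "q \<in> ?B" for q
    proof -
      have "dt X q = (m q * snd (snd q) - \<gamma> * fst (snd q) + \<kappa>) * (1 / m q)\<^sup>2 - 1 / m q * snd (snd q)"
        using V(3)[OF that] unfolding VV[OF that] Xx[OF that] by simp
      also have "\<dots> = (\<kappa> - \<gamma> * fst (snd q)) / (m q * m q)"
        using m[OF that] by (simp add: field_simps power2_eq_square)
      finally have dtX: "dt X q = (\<kappa> - \<gamma> * fst (snd q)) / (m q * m q)" .
      have "fst h * dt X q + fst (snd h) * dx X q + snd (snd h) * dv X q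
          = ((\<kappa> - \<gamma> * fst (snd q)) * fst h + m q * fst (snd h)) / (m q * m q)" for h
        unfolding dtX Xx[OF that] X(1)[OF that] using m[OF that] by (simp add: field_simps)
      then show ?thesis using sd[OF B(2) that] by simp
    qed
    show "((\<lambda>q. (fst (snd q) + l1 * fst q + l0) / m q) has_derivative
        (\<lambda>h. ((\<kappa> - \<gamma> * fst (snd q)) * fst h + m q * fst (snd h)) / (m q * m q))) (at q)" if "q \<in> ?B" for q
    proof -
      have "(fst (snd h) + l1 * fst h) * m q - (fst (snd q) + l1 * fst q + l0) * (\<gamma> * fst h)
          = (l1 * \<delta> - l0 * \<gamma> - \<gamma> * fst (snd q)) * fst h + m q * fst (snd h)" for h :: "real \<times> real \<times> real"
        by (simp add: m_def algebra_simps)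
      moreover have "((\<lambda>q. (fst (snd q) + l1 * fst q + l0) / m q) has_derivative
          (\<lambda>h. ((fst (snd h) + l1 * fst h) * m q - (fst (snd q) + l1 * fst q + l0) * (\<gamma> * fst h)) / (m q * m q))) (at q)"
        by (rule has_derivative_divide') (use m[OF that] in \<open>auto intro!: derivative_eq_intros dm\<close>)
      ultimately show ?thesis by (simp add: l(1))
    qed
  qed (use that m[OF p] l(2) in \<open>auto simp: add.assoc s_def\<close>)
  have "(T q, X q, V q) = burgers_transformation \<alpha> \<beta> \<gamma> \<delta> l1 l0 q" if "q \<in> ?B" for q
    using TT[OF that] XX[OF that] VV[OF that] l(1)
    by (simp add: burgers_transformation_def m_def split_beta)
  then show ?thesis
    using ab(1) m unfolding m_def by blast
qed

text \<open>The constants are fitted on a ball around \<open>p\<close> and may change with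
  \<open>p\<close>, as \<open>U\<close> is an arbitrary open set.\<close>

lemma burgers_point_symmetry_local_form:
  assumes sym: "burgers_point_symmetry U \<Phi>" and "p \<in> U"
  shows "\<exists>N \<alpha> \<beta> \<gamma> \<delta> l1 l0. open N \<and> p \<in> N \<and> N \<subseteq> U \<and> N \<subseteq> natural_domain \<gamma> \<delta> \<and>
     \<alpha> * \<delta> - \<beta> * \<gamma> = 1 \<and> (\<forall>q\<in>N. \<Phi> q = burgers_transformation \<alpha> \<beta> \<gamma> \<delta> l1 l0 q)"
proof -
  have "local_diffeomorphism_on U \<Phi>"
    using sym by (simp add: burgers_point_symmetry_def)
  from local_diffeomorphism_on_nhd[OF this \<open>p \<in> U\<close>] obtain e where e: "0 < e" "ball p e \<subseteq> U"
    "smooth_on (ball p e) \<Phi>" "\<And>q y. q \<in> ball p e \<Longrightarrow> \<exists>n. dir_deriv n \<Phi> q = y"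
    by blast
  define T where "T q = fst (\<Phi> q)" for q
  define X where "X q = fst (snd (\<Phi> q))" for q
  define V where "V q = snd (snd (\<Phi> q))" for q
  have \<Phi>: "\<Phi> = (\<lambda>q. (T q, X q, V q))"
    by (simp add: T_def X_def V_def fun_eq_iff)
  have B: "smooth_on (ball p e) T" "smooth_on (ball p e) X" "smooth_on (ball p e) V"
    unfolding T_def[abs_def] X_def[abs_def] V_def[abs_def]
    by (intro smooth_on_fst smooth_on_snd e(3) open_ball)+
  note sym' = sym[unfolded \<Phi>] and B' = open_ball[of p e] e(2) B
  have J: "jacobian T X V q \<noteq> 0" if "q \<in> ball p e" for q
    using e(4)[OF that] B[THEN smooth_on_differentiable, OF that] unfolding \<Phi> by (intro jacobian_nonzero) auto
  have T: "dx T q = 0" "dv T q = 0" if "q \<in> ball p e" for q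
    using point_symmetry_time_component[OF sym' B' that J[OF that]] by auto
  have X: "dv X q = 0" "(dx X q)\<^sup>2 = dt T q" "dx X q \<noteq> 0" "dv V q \<noteq> 0" if "q \<in> ball p e" for q
    using point_symmetry_space_component[OF sym' B' T that J[OF that]] by auto
  have V: "dx (dx X) q = 0" "dv (dv V) q = 0"
    "dx X q * dx (dx V) q = dx X q * dt V q + (V q * (dx X q)\<^sup>2 - dt X q) * dx V q"
    "2 * dx X q * dv (dx V) q = - dx X q * snd (snd q) * dv V q + (V q * (dx X q)\<^sup>2 - dt X q) * dv V q"
    if "q \<in> ball p e" for q
    using point_symmetry_velocity_component[OF sym' B' T X(1-3) that] by auto
  note W = determining_equations_consequences[OF open_ball B T X(1,3) V(1) X(4) V(2-4)]
  obtain \<alpha> \<beta> \<gamma> \<delta> l1 l0 where g: "\<alpha> * \<delta> - \<beta> * \<gamma> = 1" "\<forall>q\<in>ball p e. \<gamma> * fst q + \<delta> \<noteq> 0 \<and>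
      (T q, X q, V q) = burgers_transformation \<alpha> \<beta> \<gamma> \<delta> l1 l0 q"
    using integrate_determining_equations[OF e(1) B T X(1,2) W(1) V(2) W(2-8)] by blast
  have "ball p e \<subseteq> natural_domain \<gamma> \<delta>"
    using g(2) by (auto simp: natural_domain_def)
  moreover have "\<forall>q\<in>ball p e. \<Phi> q = burgers_transformation \<alpha> \<beta> \<gamma> \<delta> l1 l0 q"
    using g(2) fun_cong[OF \<Phi>] by metis
  moreover have "p \<in> ball p e" using e(1) by simp
  ultimately show ?thesis
    using e(2) g(1) open_ball by blast
qed

subsection \<open>The transformations are point symmetries\<close>

lemma burgers_transformation_eq:
  "burgers_transformation \<alpha> \<beta> \<gamma> \<delta> l1 l0 q =
    ((\<alpha> * fst q + \<beta>) / (\<gamma> * fst q + \<delta>), (fst (snd q) + l1 * fst q + l0) / (\<gamma> * fst q + \<delta>),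
     (\<gamma> * fst q + \<delta>) * snd (snd q) - \<gamma> * fst (snd q) + l1 * \<delta> - l0 * \<gamma>)"
  by (simp add: burgers_transformation_def split_beta)

lemma mem_natural_domain: "q \<in> natural_domain \<gamma> \<delta> \<longleftrightarrow> \<gamma> * fst q + \<delta> \<noteq> 0"
  by (simp add: natural_domain_def split_beta)

lemma open_natural_domain: "open (natural_domain \<gamma> \<delta>)"
proof -
  have "natural_domain \<gamma> \<delta> = {q. \<gamma> * fst q + \<delta> \<noteq> 0}"
    by (auto simp: mem_natural_domain)
  then show ?thesis
    by (simp only:) (intro open_Collect_neq continuous_intros)
qed

lemma smooth_on_burgers_transformation:
  "smooth_on (natural_domain \<gamma> \<delta>) (burgers_transformation \<alpha> \<beta> \<gamma> \<delta> l1 l0)"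
  unfolding burgers_transformation_eq[abs_def]
  by (intro smooth_on_Pair smooth_on_divide smooth_on_diff smooth_on_add smooth_on_mult smooth_on_const
      smooth_on_fst smooth_on_snd smooth_on_ident open_natural_domain) (simp_all add: mem_natural_domain)

text \<open>
  The matrix of the linear fractional action on \<open>t\<close> is inverted; the new \<open>l1\<close>, \<open>l0\<close> are read
  off from \<open>x = x' (\<gamma> t + \<delta>) - l1 t - l0\<close>.
\<close>

lemma burgers_transformation_inverse:
  assumes det: "\<alpha> * \<delta> - \<beta> * \<gamma> = 1" and q: "q \<in> natural_domain \<gamma> \<delta>"
  shows "burgers_transformation \<alpha> \<beta> \<gamma> \<delta> l1 l0 q \<in> natural_domain (- \<gamma>) \<alpha>"
    and "burgers_transformation \<delta> (- \<beta>) (- \<gamma>) \<alpha> (l0 * \<gamma> - l1 * \<delta>) (l1 * \<beta> - l0 * \<alpha>)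
      (burgers_transformation \<alpha> \<beta> \<gamma> \<delta> l1 l0 q) = q"
proof -
  obtain t x v where [simp]: "q = (t, x, v)" by (cases q)
  define m where "m = \<gamma> * t + \<delta>"
  have m: "m \<noteq> 0" using q by (simp add: mem_natural_domain m_def)
  define s where "s = (\<alpha> * t + \<beta>) / m"
  define y where "y = (x + l1 * t + l0) / m"
  have s: "s * m = \<alpha> * t + \<beta>" and y: "y * m = x + l1 * t + l0"
    using m by (simp_all add: s_def y_def)
  \<comment> \<open>The key relation: at corresponding points the denominators of the transformation
    and of its inverse are reciprocal.\<close>
  have "(- \<gamma> * s + \<alpha>) * m = \<alpha> * m - \<gamma> * (s * m)" by (simp add: algebra_simps)
  also have "\<dots> = \<alpha> * \<delta> - \<beta> * \<gamma>" unfolding s by (simp add: m_def algebra_simps)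
  finally have inv: "(- \<gamma> * s + \<alpha>) * m = 1" by (simp only: det)
  then have n: "- \<gamma> * s + \<alpha> = 1 / m" using m by (simp add: field_simps)
  have "(\<delta> * s - \<beta>) * m = \<delta> * (s * m) - \<beta> * m" by (simp add: algebra_simps)
  also have "\<dots> = (\<alpha> * \<delta> - \<beta> * \<gamma>) * t" unfolding s by (simp add: m_def algebra_simps)
  finally have t: "(\<delta> * s + - \<beta>) * m = t" by (simp add: det)
  have "(y + (l0 * \<gamma> - l1 * \<delta>) * s + (l1 * \<beta> - l0 * \<alpha>)) * m
      = y * m - l1 * ((\<delta> * s + - \<beta>) * m) - l0 * ((- \<gamma> * s + \<alpha>) * m)" by (simp add: algebra_simps)
  then have x: "(y + (l0 * \<gamma> - l1 * \<delta>) * s + (l1 * \<beta> - l0 * \<alpha>)) * m = x"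
    unfolding t inv y by simp
  define w where "w = m * v - \<gamma> * x + l1 * \<delta> - l0 * \<gamma>"
  have \<Phi>: "burgers_transformation \<alpha> \<beta> \<gamma> \<delta> l1 l0 q = (s, y, w)"
    by (simp add: burgers_transformation_eq s_def y_def w_def m_def)
  show "burgers_transformation \<alpha> \<beta> \<gamma> \<delta> l1 l0 q \<in> natural_domain (- \<gamma>) \<alpha>"
    unfolding \<Phi> mem_natural_domain fst_conv n using m by simp
  have "1 / m * w + \<gamma> * y + (l0 * \<gamma> - l1 * \<delta>) * \<alpha> - (l1 * \<beta> - l0 * \<alpha>) * - \<gamma> = v"
  proof -
    have "m * (1 / m * w + \<gamma> * y + (l0 * \<gamma> - l1 * \<delta>) * \<alpha> - (l1 * \<beta> - l0 * \<alpha>) * - \<gamma>)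
        = w + \<gamma> * (y * m) - l1 * (\<alpha> * \<delta> - \<beta> * \<gamma>) * m"
      using m by (simp add: algebra_simps)
    also have "\<dots> = m * v"
      unfolding det y by (simp add: w_def m_def algebra_simps)
    finally show ?thesis using m by simp
  qed
  moreover have "(\<delta> * s + - \<beta>) / (1 / m) = t"
    "(y + (l0 * \<gamma> - l1 * \<delta>) * s + (l1 * \<beta> - l0 * \<alpha>)) / (1 / m) = x"
    using t x by simp_all
  ultimately show "burgers_transformation \<delta> (- \<beta>) (- \<gamma>) \<alpha> (l0 * \<gamma> - l1 * \<delta>) (l1 * \<beta> - l0 * \<alpha>)
      (burgers_transformation \<alpha> \<beta> \<gamma> \<delta> l1 l0 q) = q"
    unfolding \<Phi> burgers_transformation_eq[of _ _ _ _ _ _ "(s, y, w)"] fst_conv snd_conv n by simp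
qed

text \<open>The inverse has the same form with determinant 1. Forming the constants of its inverse
  restores \<open>l1\<close> and \<open>l0\<close> up to the factor
  \<open>\<alpha> * \<delta> - \<beta> * \<gamma> = 1\<close>, so the preceding lemma applies in the
  other direction.\<close>

lemma burgers_transformation_inverse':
  assumes det: "\<alpha> * \<delta> - \<beta> * \<gamma> = 1" and q: "q \<in> natural_domain (- \<gamma>) \<alpha>"
  shows "burgers_transformation \<delta> (- \<beta>) (- \<gamma>) \<alpha> (l0 * \<gamma> - l1 * \<delta>) (l1 * \<beta> - l0 * \<alpha>) q \<in> natural_domain \<gamma> \<delta>"
    and "burgers_transformation \<alpha> \<beta> \<gamma> \<delta> l1 l0
      (burgers_transformation \<delta> (- \<beta>) (- \<gamma>) \<alpha> (l0 * \<gamma> - l1 * \<delta>) (l1 * \<beta> - l0 * \<alpha>) q) = q"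
proof -
  have det': "\<delta> * \<alpha> - - \<beta> * - \<gamma> = 1" using det by (simp add: algebra_simps)
  have "(l1 * \<beta> - l0 * \<alpha>) * - \<gamma> - (l0 * \<gamma> - l1 * \<delta>) * \<alpha> = l1 * (\<alpha> * \<delta> - \<beta> * \<gamma>)"
    "(l0 * \<gamma> - l1 * \<delta>) * - \<beta> - (l1 * \<beta> - l0 * \<alpha>) * \<delta> = l0 * (\<alpha> * \<delta> - \<beta> * \<gamma>)"
    by (simp_all add: algebra_simps)
  then have l: "(l1 * \<beta> - l0 * \<alpha>) * - \<gamma> - (l0 * \<gamma> - l1 * \<delta>) * \<alpha> = l1"
    "(l0 * \<gamma> - l1 * \<delta>) * - \<beta> - (l1 * \<beta> - l0 * \<alpha>) * \<delta> = l0"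
    unfolding det by simp_all
  show "burgers_transformation \<delta> (- \<beta>) (- \<gamma>) \<alpha> (l0 * \<gamma> - l1 * \<delta>) (l1 * \<beta> - l0 * \<alpha>) q \<in> natural_domain \<gamma> \<delta>"
    using burgers_transformation_inverse(1)[OF det' q] by simp
  show "burgers_transformation \<alpha> \<beta> \<gamma> \<delta> l1 l0
      (burgers_transformation \<delta> (- \<beta>) (- \<gamma>) \<alpha> (l0 * \<gamma> - l1 * \<delta>) (l1 * \<beta> - l0 * \<alpha>) q) = q"
    using burgers_transformation_inverse(2)[OF det' q, where ?l1.0 = "l0 * \<gamma> - l1 * \<delta>" and ?l0.0 = "l1 * \<beta> - l0 * \<alpha>"]
    unfolding l minus_minus .
qed

text \<open>The transformation is a bijection between two natural domains with inverse of the same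
  form, so the entire domain serves as the neighbourhood of each point.\<close>

lemma local_diffeomorphism_burgers_transformation:
  assumes det: "\<alpha> * \<delta> - \<beta> * \<gamma> = 1"
  shows "local_diffeomorphism_on (natural_domain \<gamma> \<delta>) (burgers_transformation \<alpha> \<beta> \<gamma> \<delta> l1 l0)"
proof -
  let ?\<Phi> = "burgers_transformation \<alpha> \<beta> \<gamma> \<delta> l1 l0"
  let ?\<Psi> = "burgers_transformation \<delta> (- \<beta>) (- \<gamma>) \<alpha> (l0 * \<gamma> - l1 * \<delta>) (l1 * \<beta> - l0 * \<alpha>)"
  note inv = burgers_transformation_inverse[OF det] and inv' = burgers_transformation_inverse'[OF det]
  have "?\<Phi> ` natural_domain \<gamma> \<delta> = natural_domain (- \<gamma>) \<alpha>"
  proof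
    show "natural_domain (- \<gamma>) \<alpha> \<subseteq> ?\<Phi> ` natural_domain \<gamma> \<delta>"
      using inv' by (metis image_eqI subsetI)
  qed (use inv(1) in blast)
  then show ?thesis
    unfolding local_diffeomorphism_on_def
    using open_natural_domain smooth_on_burgers_transformation inv(2) by (metis order_refl)
qed

section \<open>Transport of solutions\<close>

lemma has_derivative_compose_pair:
  fixes F P Q :: "real \<times> real \<Rightarrow> real"
  assumes "F differentiable (at (P r, Q r))" "(P has_derivative P') (at r)" "(Q has_derivative Q') (at r)"
  shows "((\<lambda>r. F (P r, Q r)) has_derivative
    (\<lambda>h. P' h * dir_deriv (1, 0) F (P r, Q r) + Q' h * dir_deriv (0, 1) F (P r, Q r))) (at r)"
proof -
  have "(\<lambda>h. dir_deriv (P' h, Q' h) F (P r, Q r))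
      = (\<lambda>h. P' h * dir_deriv (1, 0) F (P r, Q r) + Q' h * dir_deriv (0, 1) F (P r, Q r))"
  proof
    show "dir_deriv (P' h, Q' h) F (P r, Q r)
        = P' h * dir_deriv (1, 0) F (P r, Q r) + Q' h * dir_deriv (0, 1) F (P r, Q r)" for h
      using dir_deriv_pair[OF assms(1), of "P' h" "Q' h"] by simp
  qed
  then show ?thesis
    using has_derivative_compose[of "\<lambda>r. (P r, Q r)" _ r UNIV F, OF has_derivative_Pair[OF assms(2,3)]
        has_derivative_dir_deriv[OF assms(1)]]
    by (simp only:)
qed

text \<open>Here \<open>l1\<close> and \<open>l0\<close> are the constants of the inverse
  transformation; \<open>n\<close> is its denominator, and \<open>P\<close>, \<open>Q\<close> are
  its first two components. As \<open>\<gamma> * P r + \<delta> = 1 / n r\<close>, the function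
  shown is the third component of the transformed graph. \<open>E\<close> excludes
  \<open>n r = 0\<close> explicitly because division by zero is total.\<close>

lemma transformed_burgers_solution:
  fixes \<alpha> \<beta> \<gamma> \<delta> l1 l0 :: real
  assumes det: "\<alpha> * \<delta> - \<beta> * \<gamma> = 1" and f: "burgers_solution D f"
  defines "n \<equiv> \<lambda>r :: real \<times> real. - \<gamma> * fst r + \<alpha>"
  defines "P \<equiv> \<lambda>r. (\<delta> * fst r + - \<beta>) / n r"
  defines "Q \<equiv> \<lambda>r. (snd r + l1 * fst r + l0) / n r"
  defines "E \<equiv> {r. n r \<noteq> 0 \<and> (P r, Q r) \<in> D}"
  shows "burgers_solution E (\<lambda>r. f (P r, Q r) / n r - \<gamma> * Q r - l1)"
proof -
  define g where "g = (\<lambda>r. f (P r, Q r) / n r - \<gamma> * Q r - l1)"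
  have D: "open D" "smooth_on D f"
    and pde: "\<And>q. q \<in> D \<Longrightarrow> dir_deriv (1, 0) f q + f q * dir_deriv (0, 1) f q = dir_deriv (0, 1) (dir_deriv (0, 1) f) q"
    using f by (auto simp: burgers_solution_iff)
  define E0 where "E0 = {r. n r \<noteq> 0}"
  have E0: "open E0"
    unfolding E0_def n_def by (intro open_Collect_neq continuous_intros)
  have smn: "smooth_on E0 n"
    unfolding n_def using E0 by (intro smooth_on_add smooth_on_mult smooth_on_const smooth_on_linear bounded_linear_fst)
  have "smooth_on E0 (\<lambda>r. \<delta> * fst r + - \<beta>)" "smooth_on E0 (\<lambda>r. snd r + l1 * fst r + l0)"
    by (intro smooth_on_add smooth_on_mult smooth_on_const smooth_on_fst smooth_on_snd smooth_on_ident E0)+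
  from this[THEN smooth_on_divide[OF E0 _ smn]] have smPQ: "smooth_on E0 P" "smooth_on E0 Q"
    by (simp_all add: P_def Q_def E0_def)
  have E_eq: "E = E0 \<inter> (\<lambda>r. (P r, Q r)) -` D"
    by (auto simp: E_def E0_def)
  have "continuous_on E0 (\<lambda>r. (P r, Q r))"
    by (intro continuous_on_Pair smooth_on_continuous_on smPQ)
  then have E: "open E"
    unfolding E_eq using D(1) E0 continuous_on_open_vimage by (metis Int_commute)
  have sub: "E \<subseteq> E0" by (simp add: E_eq)
  have smF: "smooth_on E (\<lambda>r. f (P r, Q r))"
  proof (rule smooth_on_compose[OF E _ _ D(2)])
    show "(\<lambda>r. (P r, Q r)) ` E \<subseteq> D" by (auto simp: E_def)
    show "smooth_on E (\<lambda>r. (P r, Q r))"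
      by (intro smooth_on_Pair E smooth_on_subset[OF smPQ(1) sub] smooth_on_subset[OF smPQ(2) sub])
  qed
  have smg: "smooth_on E g"
    unfolding g_def
    by (intro smooth_on_diff smooth_on_divide smooth_on_mult smooth_on_const E smF
        smooth_on_subset[OF smPQ(2) sub] smooth_on_subset[OF smn sub]) (simp add: E_def)
  have dn: "(n has_derivative (\<lambda>h. - \<gamma> * fst h)) (at r)" for r
    unfolding n_def by (auto intro!: derivative_eq_intros)
  have dP: "(P has_derivative (\<lambda>h. fst h / (n r * n r))) (at r)" if r: "r \<in> E" for r
  proof -
    have "\<delta> * fst h * n r - (\<delta> * fst r + - \<beta>) * (- \<gamma> * fst h) = (\<alpha> * \<delta> - \<beta> * \<gamma>) * fst h" for h :: "real \<times> real"
      by (simp add: n_def algebra_simps)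
    moreover have "(P has_derivative
        (\<lambda>h. (\<delta> * fst h * n r - (\<delta> * fst r + - \<beta>) * (- \<gamma> * fst h)) / (n r * n r))) (at r)"
      unfolding P_def using r
      by (intro has_derivative_divide' dn) (auto simp: E_def intro!: derivative_eq_intros)
    ultimately show ?thesis by (simp add: det)
  qed
  have dQ: "(Q has_derivative (\<lambda>h. (snd h + l1 * fst h) / n r + \<gamma> * Q r * fst h / n r)) (at r)" if r: "r \<in> E" for r
  proof -
    have "(Q has_derivative (\<lambda>h. ((snd h + l1 * fst h) * n r
        - (snd r + l1 * fst r + l0) * (- \<gamma> * fst h)) / (n r * n r))) (at r)"
      unfolding Q_def using r
      by (intro has_derivative_divide' dn) (auto simp: E_def intro!: derivative_eq_intros)
    moreover have "((snd h + l1 * fst h) * n r - (snd r + l1 * fst r + l0) * (- \<gamma> * fst h)) / (n r * n r)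
        = (snd h + l1 * fst h) / n r + \<gamma> * Q r * fst h / n r" for h
      using r by (simp add: E_def Q_def field_simps)
    ultimately show ?thesis by simp
  qed
  have ED: "(P r, Q r) \<in> D" "n r \<noteq> 0" if "r \<in> E" for r
    using that by (auto simp: E_def)
  have dF: "((\<lambda>r. F (P r, Q r)) has_derivative (\<lambda>h. fst h / (n r * n r) * dir_deriv (1, 0) F (P r, Q r)
      + ((snd h + l1 * fst h) / n r + \<gamma> * Q r * fst h / n r) * dir_deriv (0, 1) F (P r, Q r))) (at r)"
    if "smooth_on D F" "r \<in> E" for F r
    by (rule has_derivative_compose_pair[OF smooth_on_differentiable[OF that(1) ED(1)[OF that(2)]] dP[OF that(2)] dQ[OF that(2)]])
  have dg: "dir_deriv h g r = (fst h / (n r * n r) * dir_deriv (1, 0) f (P r, Q r)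
      + ((snd h + l1 * fst h) / n r + \<gamma> * Q r * fst h / n r) * dir_deriv (0, 1) f (P r, Q r)) / n r
      + \<gamma> * fst h * f (P r, Q r) / (n r * n r)
      - \<gamma> * ((snd h + l1 * fst h) / n r + \<gamma> * Q r * fst h / n r)" if r: "r \<in> E" for h r
    unfolding g_def
    by (rule trans[OF dir_deriv_eq])
       (use ED(2)[OF r] in \<open>auto intro!: derivative_eq_intros dF[OF D(2) r] dn dQ[OF r] simp: field_simps\<close>)
  have "dir_deriv (0, 1) (dir_deriv (0, 1) g) r = dir_deriv (1, 0) g r + g r * dir_deriv (0, 1) g r"
    if r: "r \<in> E" for r
  proof -
    \<comment> \<open>An x-derivative leaves \<open>P\<close> fixed and turns \<open>Q\<close> into
      \<open>1 / n\<close>, so each one costs a single factor \<open>1 / n\<close>.\<close>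
    have "dir_deriv (0, 1) (dir_deriv (0, 1) g) r
        = dir_deriv (0, 1) (\<lambda>r. dir_deriv (0, 1) f (P r, Q r) / (n r * n r) - \<gamma> / n r) r"
      by (rule dir_deriv_cong[OF E r]) (simp add: dg)
    also have "\<dots> = dir_deriv (0, 1) (dir_deriv (0, 1) f) (P r, Q r) / (n r * n r * n r)"
      by (rule trans[OF dir_deriv_eq])
         (use ED(2)[OF r] in \<open>auto intro!: derivative_eq_intros dF[OF smooth_on_dir_deriv[OF D(2)] r] dn simp: field_simps\<close>)
    also have "\<dots> = (dir_deriv (1, 0) f (P r, Q r) + f (P r, Q r) * dir_deriv (0, 1) f (P r, Q r)) / (n r * n r * n r)"
      using pde[OF ED(1)[OF r]] by simp
    also have "\<dots> = dir_deriv (1, 0) g r + g r * dir_deriv (0, 1) g r"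
      unfolding dg[OF r] unfolding g_def using ED(2)[OF r] by (simp add: field_simps)
    finally show ?thesis .
  qed
  then show ?thesis
    using E smg unfolding g_def[symmetric] by (simp add: burgers_solution_iff)
qed

text \<open>The first two components depend on \<open>t\<close> and \<open>x\<close> alone and are
  invertible there, so the image of a graph is always a graph. \<open>D'\<close> is all of
  \<open>D\<close> within the domain of the transformation.\<close>

lemma burgers_transformation_maps_solutions:
  assumes det: "\<alpha> * \<delta> - \<beta> * \<gamma> = 1"
    and f: "burgers_solution D f" "q \<in> D" "graph_point f q \<in> natural_domain \<gamma> \<delta>"
  shows "maps_graph_to_solution_graph_at (natural_domain \<gamma> \<delta>) (burgers_transformation \<alpha> \<beta> \<gamma> \<delta> l1 l0) D f q"
proof -
  let ?\<Phi> = "burgers_transformation \<alpha> \<beta> \<gamma> \<delta> l1 l0"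
  define k1 where "k1 = l0 * \<gamma> - l1 * \<delta>"
  define k0 where "k0 = l1 * \<beta> - l0 * \<alpha>"
  let ?\<Psi> = "burgers_transformation \<delta> (- \<beta>) (- \<gamma>) \<alpha> k1 k0"
  define n where "n = (\<lambda>r :: real \<times> real. - \<gamma> * fst r + \<alpha>)"
  define P where "P = (\<lambda>r. (\<delta> * fst r + - \<beta>) / n r)"
  define Q where "Q = (\<lambda>r. (snd r + k1 * fst r + k0) / n r)"
  define E where "E = {r. n r \<noteq> 0 \<and> (P r, Q r) \<in> D}"
  define g where "g = (\<lambda>r. f (P r, Q r) / n r - \<gamma> * Q r - k1)"
  define D' where "D' = D \<inter> {r. \<gamma> * fst r + \<delta> \<noteq> 0}"
  have sol: "burgers_solution E g"
    unfolding g_def E_def P_def Q_def n_def by (rule transformed_burgers_solution[OF det f(1)])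
  note inv = burgers_transformation_inverse[OF det, where ?l1.0 = l1 and ?l0.0 = l0, folded k1_def k0_def]
    and inv' = burgers_transformation_inverse'[OF det, where ?l1.0 = l1 and ?l0.0 = l0, folded k1_def k0_def]
  have \<Psi>: "?\<Psi> (fst r, snd r, w) = (P r, Q r, snd (snd (?\<Psi> (fst r, snd r, w))))" for r w
    by (simp add: burgers_transformation_eq P_def Q_def n_def)
  have \<gamma>n: "\<gamma> * P r + \<delta> = 1 / n r" if "n r \<noteq> 0" for r
  proof -
    have "(\<gamma> * P r + \<delta>) * n r = \<gamma> * (\<delta> * fst r + - \<beta>) + \<delta> * n r"
      using that by (simp add: P_def field_simps)
    also have "\<dots> = \<alpha> * \<delta> - \<beta> * \<gamma>" by (simp add: n_def algebra_simps)
    finally show ?thesis using that by (simp add: det field_simps)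
  qed
  have base: "?\<Phi> (P r, Q r, f (P r, Q r)) = graph_point g r" if n: "n r \<noteq> 0" for r
  proof -
    \<comment> \<open>The third coordinate 0 is arbitrary: the first two components of the
      transformation ignore the third coordinate, so \<open>f (P r, Q r)\<close> can be substituted
      there afterwards.\<close>
    have "(fst r, snd r, 0) \<in> natural_domain (- \<gamma>) \<alpha>"
      using n by (simp add: mem_natural_domain n_def)
    from inv'(2)[OF this] have "?\<Phi> (P r, Q r, snd (snd (?\<Psi> (fst r, snd r, 0)))) = (fst r, snd r, 0)"
      using \<Psi>[of r 0] by simp
    then have "fst (?\<Phi> (P r, Q r, f (P r, Q r))) = fst r" "fst (snd (?\<Phi> (P r, Q r, f (P r, Q r)))) = snd r"
      by (auto simp: burgers_transformation_eq)
    moreover have "snd (snd (?\<Phi> (P r, Q r, f (P r, Q r)))) = g r"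
      using \<gamma>n[OF n] by (simp add: burgers_transformation_eq g_def k1_def)
    ultimately show ?thesis by (simp add: graph_point_def prod_eq_iff)
  qed
  have "open D'"
    unfolding D'_def using f(1) by (intro open_Int open_Collect_neq continuous_intros) (simp add: burgers_solution_iff)
  moreover have "q \<in> D'" "D' \<subseteq> D"
    using f(2,3) by (auto simp: D'_def mem_natural_domain graph_point_def)
  moreover have "graph_point f ` D' \<subseteq> natural_domain \<gamma> \<delta>"
    by (auto simp: D'_def mem_natural_domain graph_point_def)
  moreover have "?\<Phi> ` graph_point f ` D' = graph_point g ` E"
  proof
    show "?\<Phi> ` graph_point f ` D' \<subseteq> graph_point g ` E"
    proof
      fix z assume "z \<in> ?\<Phi> ` graph_point f ` D'"
      then obtain t x where z: "z = ?\<Phi> (graph_point f (t, x))" and r: "(t, x) \<in> D'" by auto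
      have dom: "graph_point f (t, x) \<in> natural_domain \<gamma> \<delta>"
        using r by (simp add: D'_def mem_natural_domain graph_point_def)
      obtain s y w where sy: "?\<Phi> (graph_point f (t, x)) = (s, y, w)" by (metis prod_cases3)
      have n: "n (s, y) \<noteq> 0"
        using inv(1)[OF dom] by (simp add: sy mem_natural_domain n_def)
      have "(P (s, y), Q (s, y)) = (t, x)"
        using inv(2)[OF dom, unfolded sy] \<Psi>[of "(s, y)" w] by (simp add: graph_point_def)
      then have "(s, y) \<in> E" "?\<Phi> (graph_point f (t, x)) = graph_point g (s, y)"
        using n r base[OF n] by (auto simp: E_def D'_def graph_point_def)
      then show "z \<in> graph_point g ` E" by (simp add: z)
    qed
    show "graph_point g ` E \<subseteq> ?\<Phi> ` graph_point f ` D'"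
    proof
      fix z assume "z \<in> graph_point g ` E"
      then obtain r where r: "z = graph_point g r" "r \<in> E" by blast
      then have n: "n r \<noteq> 0" and "(P r, Q r) \<in> D'"
        using \<gamma>n[of r] by (auto simp: E_def D'_def)
      moreover have "z = ?\<Phi> (graph_point f (P r, Q r))"
        using base[OF n] r(1) by (simp add: graph_point_def)
      ultimately show "z \<in> ?\<Phi> ` graph_point f ` D'" by blast
    qed
  qed
  ultimately show ?thesis
    unfolding maps_graph_to_solution_graph_at_def using sol by blast
qed

theorem theorem22:
  shows "(\<forall>U \<Phi>. burgers_point_symmetry U \<Phi> \<longrightarrow>
            (\<forall>p\<in>U. \<exists>N \<alpha> \<beta> \<gamma> \<delta> l1 l0. open N \<and> p \<in> N \<and> N \<subseteq> U \<and> N \<subseteq> natural_domain \<gamma> \<delta> \<and>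
               \<alpha> * \<delta> - \<beta> * \<gamma> = 1 \<and>
               (\<forall>q\<in>N. \<Phi> q = burgers_transformation \<alpha> \<beta> \<gamma> \<delta> l1 l0 q))) \<and>
         (\<forall>\<alpha> \<beta> \<gamma> \<delta> l1 l0. \<alpha> * \<delta> - \<beta> * \<gamma> = 1 \<longrightarrow>
            burgers_point_symmetry (natural_domain \<gamma> \<delta>)
              (burgers_transformation \<alpha> \<beta> \<gamma> \<delta> l1 l0) \<and>
            (\<forall>D f q. burgers_solution D f \<and> q \<in> D \<and> graph_point f q \<in> natural_domain \<gamma> \<delta> \<longrightarrow>
               maps_graph_to_solution_graph_at (natural_domain \<gamma> \<delta>)
                 (burgers_transformation \<alpha> \<beta> \<gamma> \<delta> l1 l0) D f q))"
proof (intro conjI allI impI ballI)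
  show "\<exists>N \<alpha> \<beta> \<gamma> \<delta> l1 l0. open N \<and> p \<in> N \<and> N \<subseteq> U \<and> N \<subseteq> natural_domain \<gamma> \<delta> \<and>
      \<alpha> * \<delta> - \<beta> * \<gamma> = 1 \<and> (\<forall>q\<in>N. \<Phi> q = burgers_transformation \<alpha> \<beta> \<gamma> \<delta> l1 l0 q)"
    if "burgers_point_symmetry U \<Phi>" "p \<in> U" for U \<Phi> p
    using that by (rule burgers_point_symmetry_local_form)
next
  fix \<alpha> \<beta> \<gamma> \<delta> l1 l0 :: real
  assume det: "\<alpha> * \<delta> - \<beta> * \<gamma> = 1"
  note maps = burgers_transformation_maps_solutions[OF det]
  show "burgers_point_symmetry (natural_domain \<gamma> \<delta>) (burgers_transformation \<alpha> \<beta> \<gamma> \<delta> l1 l0)"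
    unfolding burgers_point_symmetry_def
    using local_diffeomorphism_burgers_transformation[OF det] maps by simp
  show "maps_graph_to_solution_graph_at (natural_domain \<gamma> \<delta>) (burgers_transformation \<alpha> \<beta> \<gamma> \<delta> l1 l0) D f q"
    if "burgers_solution D f \<and> q \<in> D \<and> graph_point f q \<in> natural_domain \<gamma> \<delta>" for D f q
    using that by (intro maps) auto
qed

end
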